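(* Under the von Mises community model with parameters $(n,k,\kappa)$, as $n\to\infty$, strong detection is possible in each of the following regimes, where $A(\kappa)=I_1(\kappa)/I_0(\kappa)$. (i) $3/\epsilon<k=o(\log n)$ for some constant $\epsilon\in(0,1)$ and $\kappa\ge\left(\frac4{\pi^2}+\epsilon\right)(\log k)\left(\frac nk\right)^{\frac{4(1+\epsilon)}{k-1}}$. (ii) $k=c\log n$ for some constant $c>2$ and fixed $\kappa$ with $A^2(\kappa)\,c>2$. (iii) $k=c\log n$ for a constant $c>0$ and $\kappa\ge\frac{2\log k}{1-\cos(\pi e^{-2/c})}$. (iv) $k=\omega(\log n)$ and $\kappa\ge(1+\epsilon)\sqrt{\frac{8\log n}{k-1}}$ for some constant $\epsilon$ with $0<\epsilon<1$.
   Context: $I_0(\kappa)=\frac1{2\pi}\int_0^{2\pi}e^{\kappa\cos u}\,du$ and $I_1(\kappa)=\frac1{2\pi}\int_0^{2\pi}\cos(u)\,e^{\kappa\cos u}\,du$ are modified Bessel functions of the first kind. $\mathrm{vonMises}(\Theta,\kappa)$ ($\kappa>0$) is the distribution on $[0,2\pi)$ with density $\frac{1}{2\pi I_0(\kappa)}\exp(\kappa\cos(\theta-\Theta))$. Von Mises community model $(n,k,\kappa)$, with $2\le k\le n$ an integer and $\kappa>0$ (both possibly depending on $n$): a symmetric array of angles $X=(X_{ij})_{1\le i<j\le n}$, $X_{ij}=X_{ji}\in[0,2\pi)$, is observed, viewed as labels $X_e$ on the edges $e=\{i,j\}$ of the complete graph on $[n]$. For $C\subset[n]$, $E(C)$ is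 the set of edges with both endpoints in $C$. Under $H_0$ (law $\mathbb{Q}$) the $X_{ij}$, $i<j$, are i.i.d. uniform on $[0,2\pi)$. Under $H_1$ (law $\mathbb{P}$), a community $C^*\subset[n]$ is drawn uniformly at random among subsets of size $k$, a phase $\Theta^*$ is drawn independently and uniformly on $[0,2\pi)$, and given $(C^*,\Theta^* )$ the labels are independent with $X_e\sim\mathrm{vonMises}(\Theta^*,\kappa)$ for $e\in E(C^* )$ and $X_e$ uniform on $[0,2\pi)$ for all other edges. $k=c\log n$ is understood up to rounding to an integer; $k=\omega(\log n)$ means $k/\log n\to\infty$; $\log$ is the natural logarithm. A test is a measurable function $\phi$ of the data with values in $\{0,1\}$ ($1$ means reject $H_0$). $p_{\mathrm{fa}}(\phi)=\mathbb{Q}\{\phi(X)=1\}$ and $p_{\mathrm{miss}}(\phi)=\mathbb{P}\{\phi(X)=0\}$. Strong detection is possible if some sequence of tests has $p_{\mathrm{fa}}\to0$ and $p_{\mathrm{miss}}\to0$. *)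

theory Defs
  imports "HOL-Probability.Probability" "HOL-Library.Landau_Symbols"
begin

definition bessel_I0 :: "real \<Rightarrow> real" where
  "bessel_I0 \<kappa> = 1 / (2 * pi) * integral {0..2 * pi} (\<lambda>u. exp (\<kappa> * cos u))"

definition bessel_I1 :: "real \<Rightarrow> real" where
  "bessel_I1 \<kappa> = 1 / (2 * pi) * integral {0..2 * pi} (\<lambda>u. cos u * exp (\<kappa> * cos u))"

definition bessel_ratio :: "real \<Rightarrow> real" where
  "bessel_ratio \<kappa> = bessel_I1 \<kappa> / bessel_I0 \<kappa>"

text \<open>Distributions of angles are measures on the Borel sets of the real line that are concentrated
  on \<open>[0, 2\<pi>)\<close>.\<close>

definition uniform_angle :: "real measure" where
  "uniform_angle = uniform_measure lborel {0..<2 * pi}"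

definition von_mises :: "real \<Rightarrow> real \<Rightarrow> real measure" where
  "von_mises \<Theta> \<kappa> = density lborel (\<lambda>\<theta>.
     ennreal (1 / (2 * pi * bessel_I0 \<kappa>) * exp (\<kappa> * cos (\<theta> - \<Theta>))) * indicator {0..<2 * pi} \<theta>)"

definition edges :: "nat set \<Rightarrow> nat set set" where
  "edges C = {e. e \<subseteq> C \<and> card e = 2}"

text \<open>Indexing the labels by unordered pairs builds in the symmetry \<open>X\<^sub>i\<^sub>j = X\<^sub>j\<^sub>i\<close>.\<close>

definition null_law :: "nat \<Rightarrow> (nat set \<Rightarrow> real) measure" where
  "null_law n = (\<Pi>\<^sub>M e\<in>edges {1..n}. uniform_angle)"

definition conditional_law :: "nat \<Rightarrow> real \<Rightarrow> nat set \<Rightarrow> real \<Rightarrow> (nat set \<Rightarrow> real) measure" where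
  "conditional_law n \<kappa> C \<Theta> =
     (\<Pi>\<^sub>M e\<in>edges {1..n}. if e \<in> edges C then von_mises \<Theta> \<kappa> else uniform_angle)"

definition planted_law :: "nat \<Rightarrow> nat \<Rightarrow> real \<Rightarrow> (nat set \<Rightarrow> real) measure" where
  "planted_law n k \<kappa> =
     measure_pmf (pmf_of_set {C. C \<subseteq> {1..n} \<and> card C = k}) \<bind>
       (\<lambda>C. uniform_angle \<bind> (\<lambda>\<Theta>. conditional_law n \<kappa> C \<Theta>))"

definition is_test :: "nat \<Rightarrow> ((nat set \<Rightarrow> real) \<Rightarrow> nat) \<Rightarrow> bool" where
  "is_test n \<phi> \<longleftrightarrow> \<phi> \<in> (\<Pi>\<^sub>M e\<in>edges {1..n}. borel) \<rightarrow>\<^sub>M count_space {0, 1}"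

definition p_fa :: "nat \<Rightarrow> ((nat set \<Rightarrow> real) \<Rightarrow> nat) \<Rightarrow> real" where
  "p_fa n \<phi> = measure (null_law n) {X \<in> space (null_law n). \<phi> X = 1}"

definition p_miss :: "nat \<Rightarrow> nat \<Rightarrow> real \<Rightarrow> ((nat set \<Rightarrow> real) \<Rightarrow> nat) \<Rightarrow> real" where
  "p_miss n k \<kappa> \<phi> = measure (planted_law n k \<kappa>) {X \<in> space (planted_law n k \<kappa>). \<phi> X = 0}"

definition strong_detection_possible :: "(nat \<Rightarrow> nat) \<Rightarrow> (nat \<Rightarrow> real) \<Rightarrow> bool" where
  "strong_detection_possible k \<kappa> \<longleftrightarrow>
     (\<exists>\<phi>. (\<forall>n. is_test n (\<phi> n)) \<and>
          (\<lambda>n. p_fa n (\<phi> n)) \<longlonglongrightarrow> 0 \<and>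
          (\<lambda>n. p_miss n (k n) (\<kappa> n) (\<phi> n)) \<longlonglongrightarrow> 0)"

text \<open>\<open>k = c log n\<close> up to rounding: \<open>k n\<close> is the floor or the ceiling of \<open>c log n\<close>.\<close>

definition log_size :: "real \<Rightarrow> (nat \<Rightarrow> nat) \<Rightarrow> bool" where
  "log_size c k \<longleftrightarrow> (\<forall>\<^sub>F n in sequentially. \<bar>real (k n) - c * ln (real n)\<bar> < 1)"

end

theory Submission
  imports Defs "HOL-Real_Asymp.Real_Asymp"
begin

text \<open>
  Every test used here looks for a community \<open>C\<close> whose labels cluster around a common phase \<open>\<theta>\<close>, with \<open>\<theta>\<close> ranging
  over a finite grid. False alarms are bounded by a union bound over the \<open>n choose k\<close> communities and the grid
  phases; a miss is bounded by looking only at the true community and a grid phase close to the true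
  one (\<open>detection_by_union_bound\<close>). A community has \<open>N = k (k - 1) / 2\<close> edges, so per edge the
  evidence has to beat an entropy of about \<open>2 log n / (k - 1)\<close>. Two notions of clustering are used.

  The scan test compares the average of \<open>cos (X\<^sub>e - \<theta>)\<close> with a threshold just below its mean \<open>A(\<kappa>)\<close> in
  the community. Under the null law the cosine of a uniform angle has moment generating function \<open>I\<^sub>0\<close>,
  and \<open>I\<^sub>0(l) \<le> exp (l\<^sup>2 / 4)\<close>, so an average of at least \<open>a\<close> has probability at most \<open>exp (- N a\<^sup>2)\<close>.
  Hence detection is possible when \<open>A(\<kappa>)\<^sup>2 (k - 1) / 2\<close> exceeds \<open>log n\<close> by a constant factor
  (\<open>scan_detection\<close>). For \<open>k\<close> about \<open>c log n\<close> this is \<open>A\<^sup>2 c > 2\<close>; for much larger \<open>k\<close> the critical \<open>\<kappa>\<close> tends to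
  \<open>0\<close>, \<open>A(\<kappa>)\<close> is about \<open>\<kappa> / 2\<close>, and the condition becomes the one with \<open>8 log n / (k - 1)\<close>.

  The arc test asks that all labels of the community lie in one arc of half-width \<open>\<beta>\<close>
  (\<open>arc_detection\<close>). Under the null law this has probability \<open>(\<beta> / \<pi>)\<^sup>N\<close>; in the community it fails
  with probability at most \<open>N\<close> times the von Mises tail, which is of order
  \<open>exp (- \<kappa> (1 - cos \<alpha>)) / (\<surd>\<kappa> sin \<alpha>)\<close> (\<open>von_mises_tail_le\<close>) for a slightly smaller half-width \<open>\<alpha>\<close>. For \<open>k\<close> about
  \<open>c log n\<close> the half-width that balances the entropy is \<open>\<pi> exp (- 2 / c)\<close>; for smaller \<open>k\<close> it shrinks like
  a power of \<open>k / n\<close>, and \<open>\<kappa>\<close> has to be large compared with its inverse square.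
\<close>

section \<open>Integration over the circle\<close>

lemma uniform_angle_eq_density:
  "uniform_angle = density lborel (\<lambda>x. ennreal (indicator {0..<2 * pi} x / (2 * pi)))"
  unfolding uniform_angle_def uniform_measure_def
  by (intro density_cong) (auto simp: indicator_def divide_ennreal[symmetric] simp flip: ennreal_1)

lemma sets_uniform_angle [measurable_cong, simp]: "sets uniform_angle = sets borel"
  by (simp add: uniform_angle_def)

lemma space_uniform_angle [simp]: "space uniform_angle = UNIV"
  by (simp add: uniform_angle_def)

lemma prob_space_uniform_angle: "prob_space uniform_angle"
  unfolding uniform_angle_def by (rule prob_space_uniform_measure) auto

interpretation uniform_angle: prob_space uniform_angle
  by (rule prob_space_uniform_angle)

lemma measure_uniform_angle_UNIV [simp]: "measure uniform_angle UNIV = 1"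
  using uniform_angle.prob_space by simp

lemma nn_integral_uniform_angle:
  assumes "f \<in> borel_measurable borel"
  shows "(\<integral>\<^sup>+x. f x \<partial>uniform_angle) = (\<integral>\<^sup>+x. f x * indicator {0..<2 * pi} x \<partial>lborel) / ennreal (2 * pi)"
  using assms unfolding uniform_angle_def by (subst nn_integral_uniform_measure) auto

text \<open>Translate the window \<open>[0, 2\<pi>)\<close> by \<open>-t\<close>; the piece that sticks out to the left of \<open>0\<close>
  is moved back in by one period.\<close>

lemma nn_integral_uniform_angle_shift_aux:
  fixes f :: "real \<Rightarrow> ennreal"
  assumes [measurable]: "f \<in> borel_measurable borel"
    and periodic: "\<And>x. f (x + 2 * pi) = f x" and t: "0 \<le> t" "t \<le> 2 * pi"
  shows "(\<integral>\<^sup>+x. f (x - t) \<partial>uniform_angle) = (\<integral>\<^sup>+x. f x \<partial>uniform_angle)"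
proof -
  have "(\<integral>\<^sup>+x. f (x - t) * indicator {0..<2 * pi} x \<partial>lborel) =
        (\<integral>\<^sup>+x. f x * indicator {0..<2 * pi} (t + x) \<partial>lborel)"
    by (subst nn_integral_real_affine[where c = 1 and t = t]) auto
  also have "\<dots> = (\<integral>\<^sup>+x. f x * indicator {- t..<0} x + f x * indicator {0..<2 * pi - t} x \<partial>lborel)"
    using t by (intro nn_integral_cong) (auto split: split_indicator)
  also have "\<dots> = (\<integral>\<^sup>+x. f x * indicator {- t..<0} x \<partial>lborel)
      + (\<integral>\<^sup>+x. f x * indicator {0..<2 * pi - t} x \<partial>lborel)"
    by (intro nn_integral_add) auto
  also have "(\<integral>\<^sup>+x. f x * indicator {- t..<0} x \<partial>lborel) =
      (\<integral>\<^sup>+x. f (-2 * pi + x) * indicator {- t..<0} (-2 * pi + x) \<partial>lborel)"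
    by (subst nn_integral_real_affine[where c = 1 and t = "-2 * pi"]) auto
  also have "\<dots> = (\<integral>\<^sup>+x. f x * indicator {2 * pi - t..<2 * pi} x \<partial>lborel)"
    using periodic[of "- 2 * pi + x" for x]
    by (intro nn_integral_cong) (auto split: split_indicator)
  also have "\<dots> + (\<integral>\<^sup>+x. f x * indicator {0..<2 * pi - t} x \<partial>lborel) =
      (\<integral>\<^sup>+x. f x * indicator {2 * pi - t..<2 * pi} x + f x * indicator {0..<2 * pi - t} x \<partial>lborel)"
    by (intro nn_integral_add[symmetric]) auto
  also have "\<dots> = (\<integral>\<^sup>+x. f x * indicator {0..<2 * pi} x \<partial>lborel)"
    using t by (intro nn_integral_cong) (auto split: split_indicator)
  finally show ?thesis
    by (simp add: nn_integral_uniform_angle)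
qed

text \<open>Rotation invariance of the uniform law. Angles are represented by real numbers in a fixed window
  and the translate \<open>x - t\<close> is not reduced modulo \<open>2\<pi>\<close>, so the invariance holds for periodic
  integrands only. It reduces every statement about a phase \<open>\<Theta>\<close> to the phase \<open>0\<close>.\<close>

lemma nn_integral_uniform_angle_shift:
  fixes f :: "real \<Rightarrow> ennreal"
  assumes m: "f \<in> borel_measurable borel" and periodic: "\<And>x. f (x + 2 * pi) = f x"
  shows "(\<integral>\<^sup>+x. f (x - t) \<partial>uniform_angle) = (\<integral>\<^sup>+x. f x \<partial>uniform_angle)"
proof -
  interpret f: periodic_fun_simple f "2 * pi"
    by unfold_locales (rule periodic)
  define s where "s = t - of_int \<lfloor>t / (2 * pi)\<rfloor> * (2 * pi)"
  have "0 \<le> s" "s \<le> 2 * pi"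
    using floor_divide_lower[of "2 * pi" t] floor_divide_upper[of "2 * pi" t]
    by (simp_all add: s_def distrib_right)
  moreover have "f (x - t) = f (x - s)" for x
    using f.minus_of_int[of "x - s" "\<lfloor>t / (2 * pi)\<rfloor>"] by (simp add: s_def algebra_simps)
  ultimately show ?thesis
    using nn_integral_uniform_angle_shift_aux[OF m periodic] by simp
qed

lemma integrable_uniform_angle:
  fixes f :: "real \<Rightarrow> real"
  assumes "continuous_on UNIV f"
  shows "integrable uniform_angle f"
proof -
  have m: "f \<in> borel_measurable borel"
    using assms by (rule borel_measurable_continuous_onI)
  have "compact (f ` {0..2 * pi})"
    by (intro compact_continuous_image continuous_on_subset[OF assms]) auto
  then obtain B where B: "\<And>x. x \<in> {0..2 * pi} \<Longrightarrow> \<bar>f x\<bar> \<le> B"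
    by (metis bounded_real compact_imp_bounded imageI)
  have "AE x in uniform_angle. norm (f x) \<le> B"
    unfolding uniform_angle_def by (rule AE_uniform_measureI) (auto intro!: AE_I2 B)
  then show ?thesis
    by (rule uniform_angle.integrable_const_bound)
      (simp add: m measurable_cong_sets[OF sets_uniform_angle refl])
qed

lemma integral_uniform_angle:
  fixes f :: "real \<Rightarrow> real"
  assumes "continuous_on UNIV f"
  shows "(\<integral>x. f x \<partial>uniform_angle) = 1 / (2 * pi) * integral {0..2 * pi} f"
proof -
  have m: "f \<in> borel_measurable borel"
    using assms by (rule borel_measurable_continuous_onI)
  have c: "set_integrable lborel {0..2 * pi} f"
    by (intro borel_integrable_compact[unfolded set_integrable_def[symmetric]]
        borel_integrable_atLeastAtMost' continuous_on_subset[OF assms]) auto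
  have "(\<integral>x. f x \<partial>uniform_angle) = (\<integral>x. (indicator {0..<2 * pi} x / (2 * pi)) *\<^sub>R f x \<partial>lborel)"
    unfolding uniform_angle_eq_density by (subst integral_density) (auto simp: m)
  also have "\<dots> = (\<integral>x. 1 / (2 * pi) * (indicator {0..2 * pi} x *\<^sub>R f x) \<partial>lborel)"
    using AE_lborel_singleton[of "2 * pi"]
    by (intro integral_cong_AE borel_measurable_scaleR borel_measurable_times measurable_lborel1)
      (auto simp: m elim!: eventually_mono split: split_indicator)
  also have "\<dots> = 1 / (2 * pi) * (LINT x:{0..2 * pi}|lborel. f x)"
    by (subst integral_mult_right_zero) (simp add: set_lebesgue_integral_def)
  finally show ?thesis
    using set_borel_integral_eq_integral(2)[OF c] by simp
qed

lemma integral_uniform_angle_shift: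
  fixes f :: "real \<Rightarrow> real"
  assumes cont: "continuous_on UNIV f"
    and periodic: "\<And>x. f (x + 2 * pi) = f x"
  shows "(\<integral>x. f (x - t) \<partial>uniform_angle) = (\<integral>x. f x \<partial>uniform_angle)"
proof -
  have m: "f \<in> borel_measurable borel"
    using cont by (rule borel_measurable_continuous_onI)
  have i: "integrable uniform_angle f" "integrable uniform_angle (\<lambda>x. f (x - t))"
    by (intro integrable_uniform_angle continuous_on_compose2[OF cont] continuous_intros; simp)+
  show ?thesis
    using nn_integral_uniform_angle_shift[of "\<lambda>x. ennreal (f x)" t]
      nn_integral_uniform_angle_shift[of "\<lambda>x. ennreal (- f x)" t] m
    by (simp add: real_lebesgue_integral_def i periodic)
qed

text \<open>Integration by parts on the circle: there is no boundary term.\<close>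

lemma integral_uniform_angle_deriv_eq_0:
  fixes F f :: "real \<Rightarrow> real"
  assumes "\<And>x. (F has_real_derivative f x) (at x)" and "continuous_on UNIV f"
    and "F (2 * pi) = F 0"
  shows "(\<integral>x. f x \<partial>uniform_angle) = 0"
proof -
  have "(f has_integral F (2 * pi) - F 0) {0..2 * pi}"
    by (intro fundamental_theorem_of_calculus)
      (auto intro!: has_vector_derivative_at_within assms(1)
        simp flip: has_real_derivative_iff_has_vector_derivative intro: has_field_derivative_at_within[OF assms(1)])
  then have "integral {0..2 * pi} f = 0"
    using assms(3) by (simp add: integral_unique)
  then show ?thesis
    by (simp add: integral_uniform_angle[OF assms(2)])
qed

section \<open>Modified Bessel functions\<close>

lemma bessel_I0_eq: "bessel_I0 \<kappa> = (\<integral>u. exp (\<kappa> * cos u) \<partial>uniform_angle)"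
  unfolding bessel_I0_def by (subst integral_uniform_angle) (auto intro!: continuous_intros)

lemma bessel_I1_eq: "bessel_I1 \<kappa> = (\<integral>u. cos u * exp (\<kappa> * cos u) \<partial>uniform_angle)"
  unfolding bessel_I1_def by (subst integral_uniform_angle) (auto intro!: continuous_intros)

lemma bessel_I0_pos: "bessel_I0 \<kappa> > 0"
proof -
  have "(\<integral>u. exp (- \<bar>\<kappa>\<bar>) \<partial>uniform_angle) \<le> bessel_I0 \<kappa>"
    unfolding bessel_I0_eq
  proof (intro integral_mono integrable_uniform_angle continuous_intros)
    fix u 
    have "\<bar>\<kappa> * cos u\<bar> \<le> \<bar>\<kappa>\<bar> * 1"
      unfolding abs_mult by (intro mult_left_mono) auto
    then show "exp (- \<bar>\<kappa>\<bar>) \<le> exp (\<kappa> * cos u)"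
      by simp
  qed
  then show ?thesis by (simp add: uniform_angle.prob_space) (meson exp_gt_zero less_le_trans)
qed

text \<open>Integrate the derivative of \<open>sin u * exp (\<kappa> * cos u)\<close>. The factor \<open>\<kappa>\<close> in front makes both
  bounds on \<open>I\<^sub>1\<close> below possible: \<open>I\<^sub>1\<close> is close to \<open>\<kappa> I\<^sub>0 / 2\<close> for small \<open>\<kappa>\<close>, because then
  \<open>(sin u)\<^sup>2\<close> averages to about one half.\<close>

lemma bessel_I1_eq_sin:
  "bessel_I1 \<kappa> = \<kappa> * (\<integral>u. (sin u)\<^sup>2 * exp (\<kappa> * cos u) \<partial>uniform_angle)"
proof -
  have "(\<integral>u. cos u * exp (\<kappa> * cos u) - \<kappa> * ((sin u)\<^sup>2 * exp (\<kappa> * cos u)) \<partial>uniform_angle) = 0"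
    by (rule integral_uniform_angle_deriv_eq_0[where F = "\<lambda>u. sin u * exp (\<kappa> * cos u)"])
      (auto intro!: derivative_eq_intros continuous_intros simp: power2_eq_square algebra_simps)
  then show ?thesis
    unfolding bessel_I1_eq
    by (subst (asm) Bochner_Integration.integral_diff)
      (auto intro!: integrable_uniform_angle continuous_intros)
qed

lemma integral_cos_double_eq_0: "(\<integral>u. cos (2 * u) \<partial>uniform_angle) = 0"
  by (rule integral_uniform_angle_deriv_eq_0[where F = "\<lambda>u. sin (2 * u) / 2"])
    (auto intro!: derivative_eq_intros continuous_intros)

text \<open>This integral is the Bessel function \<open>I\<^sub>2\<close>. By the symmetry \<open>u \<mapsto> u - \<pi>\<close> the exponential may be
  replaced by a hyperbolic cosine, which, like \<open>cos (2 * u)\<close>, increases with \<open>\<bar>cos u\<bar>\<close>. So the two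
  factors are nonnegatively correlated, and \<open>cos (2 * u)\<close> has mean zero.\<close>

lemma integral_cos_double_exp_nonneg:
  "(\<integral>u. cos (2 * u) * exp (\<kappa> * cos u) \<partial>uniform_angle) \<ge> 0"
proof -
  let ?h = "\<lambda>y. exp (\<kappa> * y) + exp (- \<kappa> * y)"
  have cosh_eq: "?h y = 2 * cosh (\<bar>\<kappa>\<bar> * \<bar>y\<bar>)" for y
    by (cases "\<kappa> \<ge> 0"; cases "y \<ge> 0") (auto simp: cosh_field_def)
  have pi_shift: "(\<integral>u. cos (2 * u) * exp (- \<kappa> * cos u) \<partial>uniform_angle) =
        (\<integral>u. cos (2 * u) * exp (\<kappa> * cos u) \<partial>uniform_angle)"
    using integral_uniform_angle_shift[of "\<lambda>u. cos (2 * u) * exp (\<kappa> * cos u)" pi]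
    by (simp add: continuous_intros algebra_simps cos_diff cos_add sin_double cos_double)
  have "(\<integral>u. cos (2 * u) * ?h (sqrt (1/2)) \<partial>uniform_angle) \<le> (\<integral>u. cos (2 * u) * ?h (cos u) \<partial>uniform_angle)"
  proof (intro integral_mono integrable_uniform_angle continuous_intros)
    fix u :: real
    have *: "cos (2 * u) = 2 * ((cos u)\<^sup>2 - (sqrt (1/2))\<^sup>2)"
      by (simp add: cos_double_cos)
    show "cos (2 * u) * ?h (sqrt (1/2)) \<le> cos (2 * u) * ?h (cos u)"
    proof (cases "\<bar>cos u\<bar> \<le> sqrt (1/2)")
      case True
      then have "(cos u)\<^sup>2 \<le> (sqrt (1/2))\<^sup>2"
        by (metis abs_ge_zero power2_abs power_mono)
      moreover have "?h (cos u) \<le> ?h (sqrt (1/2))"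
        unfolding cosh_eq using True by (simp add: cosh_real_nonneg_le_iff mult_left_mono)
      ultimately show ?thesis
        unfolding * by (intro mult_left_mono_neg) auto
    next
      case False
      then have "(cos u)\<^sup>2 \<ge> (sqrt (1/2))\<^sup>2"
        by (metis linorder_linear power2_abs power_mono real_sqrt_ge_0_iff zero_le_divide_1_iff zero_le_numeral)
      moreover have "?h (cos u) \<ge> ?h (sqrt (1/2))"
        unfolding cosh_eq using False by (simp add: cosh_real_nonneg_le_iff mult_left_mono)
      ultimately show ?thesis
        unfolding * by (intro mult_left_mono) auto
    qed
  qed
  then show ?thesis
    using pi_shift
    by (simp add: distrib_left integral_cos_double_eq_0 integrable_uniform_angle continuous_intros)
qed

lemma bessel_I1_le: 
  assumes "\<kappa> \<ge> 0"
  shows "bessel_I1 \<kappa> \<le> \<kappa> / 2 * bessel_I0 \<kappa>"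
proof -
  have "(\<integral>u. (sin u)\<^sup>2 * exp (\<kappa> * cos u) \<partial>uniform_angle) =
      (\<integral>u. exp (\<kappa> * cos u) / 2 - cos (2 * u) * exp (\<kappa> * cos u) / 2 \<partial>uniform_angle)"
    by (intro Bochner_Integration.integral_cong) (simp_all add: cos_double_sin diff_divide_distrib ring_distribs)
  also have "\<dots> = bessel_I0 \<kappa> / 2 - (\<integral>u. cos (2 * u) * exp (\<kappa> * cos u) \<partial>uniform_angle) / 2"
    unfolding bessel_I0_eq
    by (subst Bochner_Integration.integral_diff)
      (auto intro!: integrable_uniform_angle continuous_intros)
  also have "\<dots> \<le> bessel_I0 \<kappa> / 2"
    using integral_cos_double_exp_nonneg[of \<kappa>] by simp
  finally show ?thesis
    unfolding bessel_I1_eq_sin using assms by (auto dest: mult_left_mono[of _ _ \<kappa>])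
qed

lemma bessel_I0_has_derivative: "(bessel_I0 has_real_derivative bessel_I1 \<kappa>) (at \<kappa>)"
proof -
  have "((\<lambda>\<kappa>. integral (cbox 0 (2 * pi)) (\<lambda>u. exp (\<kappa> * cos u))) has_real_derivative
      integral (cbox 0 (2 * pi)) (\<lambda>u. cos u * exp (\<kappa> * cos u))) (at \<kappa> within UNIV)"
    by (rule leibniz_rule_field_derivative)
      (auto intro!: derivative_eq_intros continuous_intros integrable_continuous_interval
        simp: split_beta)
  then have "((\<lambda>\<kappa>. 1 / (2 * pi) * integral {0..2 * pi} (\<lambda>u. exp (\<kappa> * cos u))) has_real_derivative
      bessel_I1 \<kappa>) (at \<kappa>)"
    unfolding bessel_I1_def by (intro DERIV_cmult) simp
  then show ?thesis
    by (simp add: bessel_I0_def[abs_def])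
qed

text \<open>The cosine of a uniform angle is sub-Gaussian with its own variance \<open>1/2\<close>: the logarithmic derivative
  \<open>I\<^sub>1 / I\<^sub>0\<close> of \<open>I\<^sub>0\<close> is at most \<open>\<kappa> / 2\<close>. The constant \<open>1/4\<close> is the one that
  leads to the sharp threshold of the scan test.\<close>

lemma bessel_I0_le:
  assumes "\<kappa> \<ge> 0"
  shows "bessel_I0 \<kappa> \<le> exp (\<kappa>\<^sup>2 / 4)"
proof -
  have le: "bessel_I1 x * 2 \<le> x * bessel_I0 x" if "x \<ge> 0" for x
    using bessel_I1_le[OF that] by simp
  have "bessel_I0 \<kappa> * exp (- \<kappa>\<^sup>2 / 4) \<le> bessel_I0 0 * exp (- 0\<^sup>2 / 4)"
  proof (rule DERIV_nonpos_imp_nonincreasing[OF assms])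
    fix x assume "0 \<le> x" "x \<le> \<kappa>"
    then show "\<exists>y. ((\<lambda>x. bessel_I0 x * exp (- x\<^sup>2 / 4)) has_real_derivative y) (at x) \<and> y \<le> 0"
      by (intro exI[of _ "(bessel_I1 x - x / 2 * bessel_I0 x) * exp (- x\<^sup>2 / 4)"])
        (auto intro!: derivative_eq_intros bessel_I0_has_derivative mult_nonpos_nonneg le
          simp: field_simps)
  qed
  moreover have "bessel_I0 0 = 1"
    by (simp add: bessel_I0_eq uniform_angle.prob_space)
  ultimately show ?thesis
    by (simp add: exp_minus field_simps)
qed

text \<open>\<open>A(\<kappa>)\<close> is the mean of \<open>cos u\<close> under a density proportional to \<open>exp (\<kappa> * cos u)\<close>. Increasing
  \<open>\<kappa>\<close> reweights by an increasing function of \<open>cos u\<close>, hence increases the mean.\<close>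

lemma bessel_ratio_mono:
  assumes "\<kappa> \<le> \<kappa>'"
  shows "bessel_ratio \<kappa> \<le> bessel_ratio \<kappa>'"
proof -
  define A where "A = bessel_ratio \<kappa>"
  let ?w = "exp ((\<kappa>' - \<kappa>) * A)"
  \<comment> \<open>Compare the new weight \<open>exp ((\<kappa>' - \<kappa>) * cos u)\<close> with its value \<open>?w\<close> at \<open>cos u = A\<close>: their difference
    has the sign of \<open>cos u - A\<close>.\<close>
  have "(\<integral>u. ?w * (cos u * exp (\<kappa> * cos u) - A * exp (\<kappa> * cos u)) \<partial>uniform_angle) \<le>
        (\<integral>u. cos u * exp (\<kappa>' * cos u) - A * exp (\<kappa>' * cos u) \<partial>uniform_angle)"
  proof (intro integral_mono integrable_uniform_angle continuous_intros)
    fix u :: real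
    have "(cos u - A) * ?w \<le> (cos u - A) * exp ((\<kappa>' - \<kappa>) * cos u)"
    proof (cases "cos u \<ge> A")
      case True
      then show ?thesis using assms by (intro mult_left_mono) (auto intro!: mult_left_mono)
    next
      case False
      then show ?thesis using assms by (intro mult_left_mono_neg) (auto intro!: mult_left_mono)
    qed
    then have "(cos u - A) * ?w * exp (\<kappa> * cos u) \<le> (cos u - A) * exp ((\<kappa>' - \<kappa>) * cos u) * exp (\<kappa> * cos u)"
      by (rule mult_right_mono) simp
    then show "?w * (cos u * exp (\<kappa> * cos u) - A * exp (\<kappa> * cos u))
        \<le> cos u * exp (\<kappa>' * cos u) - A * exp (\<kappa>' * cos u)"
      by (simp add: algebra_simps flip: exp_add)
  qed
  also have "\<dots> = bessel_I1 \<kappa>' - A * bessel_I0 \<kappa>'"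
    unfolding bessel_I1_eq bessel_I0_eq
    by (subst Bochner_Integration.integral_diff)
      (auto intro!: integrable_uniform_angle continuous_intros)
  also have "(\<integral>u. ?w * (cos u * exp (\<kappa> * cos u) - A * exp (\<kappa> * cos u)) \<partial>uniform_angle) =
      ?w * (bessel_I1 \<kappa> - A * bessel_I0 \<kappa>)"
    unfolding bessel_I1_eq bessel_I0_eq
    by (subst integral_mult_right_zero, subst Bochner_Integration.integral_diff)
      (auto intro!: integrable_uniform_angle continuous_intros)
  also have "\<dots> = 0"
    using bessel_I0_pos[of \<kappa>] by (simp add: A_def bessel_ratio_def)
  finally show ?thesis
    using bessel_I0_pos[of \<kappa>'] by (simp add: A_def[symmetric] bessel_ratio_def[of \<kappa>'] field_simps)
qed

lemma bessel_ratio_le_1: "bessel_ratio \<kappa> \<le> 1"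
proof -
  have "bessel_I1 \<kappa> \<le> bessel_I0 \<kappa>"
    unfolding bessel_I1_eq bessel_I0_eq
    by (intro integral_mono integrable_uniform_angle continuous_intros) auto
  then show ?thesis
    using bessel_I0_pos[of \<kappa>] by (simp add: bessel_ratio_def)
qed

text \<open>Crude, but of the correct order \<open>\<kappa> / 2\<close> as \<open>\<kappa>\<close> tends to \<open>0\<close>, which is where it is used.\<close>

lemma bessel_ratio_ge:
  assumes "\<kappa> \<ge> 0"
  shows "bessel_ratio \<kappa> \<ge> \<kappa> / 2 * exp (- 2 * \<kappa>)"
proof -
  have "(\<integral>u. (1 - cos (2 * u)) / 2 * exp (- \<kappa>) \<partial>uniform_angle)
      \<le> (\<integral>u. (sin u)\<^sup>2 * exp (\<kappa> * cos u) \<partial>uniform_angle)"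
  proof (intro integral_mono integrable_uniform_angle continuous_intros)
    fix u :: real
    show "(1 - cos (2 * u)) / 2 * exp (- \<kappa>) \<le> (sin u)\<^sup>2 * exp (\<kappa> * cos u)"
      using mult_left_mono[OF cos_ge_minus_one[of u] assms] by (simp add: cos_double_sin mult_left_mono)
  qed auto
  also have "(\<integral>u. (1 - cos (2 * u)) / 2 * exp (- \<kappa>) \<partial>uniform_angle) = exp (- \<kappa>) / 2"
    by (subst integral_mult_left_zero, subst integral_divide_zero, subst Bochner_Integration.integral_diff)
      (auto simp: integral_cos_double_eq_0 uniform_angle.prob_space intro!: integrable_uniform_angle continuous_intros)
  finally have "\<kappa> * (exp (- \<kappa>) / 2) \<le> bessel_I1 \<kappa>"
    unfolding bessel_I1_eq_sin using assms by (rule mult_left_mono)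
  moreover have "bessel_I0 \<kappa> \<le> exp \<kappa>"
  proof -
    have "bessel_I0 \<kappa> \<le> (\<integral>u. exp \<kappa> \<partial>uniform_angle)"
      unfolding bessel_I0_eq
      by (intro integral_mono integrable_uniform_angle continuous_intros)
        (use mult_left_mono[OF cos_le_one assms] in auto)
    then show ?thesis by (simp add: uniform_angle.prob_space)
  qed
  ultimately have "\<kappa> * (exp (- \<kappa>) / 2) / exp \<kappa> \<le> bessel_I1 \<kappa> / bessel_I0 \<kappa>"
    using bessel_I0_pos[of \<kappa>] assms by (intro frac_le order_trans[of 0 "\<kappa> * (exp (- \<kappa>) / 2)" "bessel_I1 \<kappa>"]) auto
  moreover have "exp (- 2 * \<kappa>) = exp (- \<kappa>) / exp \<kappa>"
    by (simp flip: exp_diff)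
  ultimately show ?thesis
    by (simp add: bessel_ratio_def)
qed

lemma bessel_ratio_pos:
  assumes "\<kappa> > 0" shows "bessel_ratio \<kappa> > 0"
proof -
  have "0 < \<kappa> / 2 * exp (- 2 * \<kappa>)" using assms by simp
  also have "\<dots> \<le> bessel_ratio \<kappa>" using assms by (intro bessel_ratio_ge) simp
  finally show ?thesis .
qed

section \<open>The von Mises distribution\<close>

lemma von_mises_eq_density:
  "von_mises \<Theta> \<kappa> = density uniform_angle (\<lambda>x. ennreal (exp (\<kappa> * cos (x - \<Theta>)) / bessel_I0 \<kappa>))"
  unfolding von_mises_def uniform_angle_eq_density using bessel_I0_pos[of \<kappa>]
  by (subst density_density_eq)
    (auto intro!: density_cong split: split_indicator simp flip: ennreal_mult)

lemma sets_von_mises [measurable_cong, simp]: "sets (von_mises \<Theta> \<kappa>) = sets borel"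
  by (simp add: von_mises_def)

lemma space_von_mises [simp]: "space (von_mises \<Theta> \<kappa>) = UNIV"
  by (simp add: von_mises_def)

lemma nn_integral_von_mises:
  assumes [measurable]: "f \<in> borel_measurable borel"
  shows "(\<integral>\<^sup>+x. f x \<partial>von_mises \<Theta> \<kappa>) =
    (\<integral>\<^sup>+x. ennreal (exp (\<kappa> * cos (x - \<Theta>)) / bessel_I0 \<kappa>) * f x \<partial>uniform_angle)"
  unfolding von_mises_eq_density by (subst nn_integral_density) auto

lemma prob_space_von_mises: "prob_space (von_mises \<Theta> \<kappa>)"
proof
  have "emeasure (von_mises \<Theta> \<kappa>) UNIV = (\<integral>\<^sup>+x. 1 \<partial>von_mises \<Theta> \<kappa>)"
    by simp
  also have "\<dots> = (\<integral>\<^sup>+x. ennreal (exp (\<kappa> * cos (x - \<Theta>)) / bessel_I0 \<kappa>) \<partial>uniform_angle)"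
    by (subst nn_integral_von_mises) auto
  also have "\<dots> = (\<integral>\<^sup>+x. ennreal (exp (\<kappa> * cos x) / bessel_I0 \<kappa>) \<partial>uniform_angle)"
    by (rule nn_integral_uniform_angle_shift) auto
  also have "\<dots> = ennreal (\<integral>x. exp (\<kappa> * cos x) / bessel_I0 \<kappa> \<partial>uniform_angle)"
    using bessel_I0_pos[of \<kappa>]
    by (intro nn_integral_eq_integral integrable_uniform_angle continuous_intros) auto
  also have "\<dots> = 1"
    using bessel_I0_pos[of \<kappa>] by (simp add: bessel_I0_eq[symmetric])
  finally show "emeasure (von_mises \<Theta> \<kappa>) (space (von_mises \<Theta> \<kappa>)) = 1"
    by simp
qed

interpretation von_mises: prob_space "von_mises \<Theta> \<kappa>" for \<Theta> \<kappa>
  by (rule prob_space_von_mises)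

text \<open>Makes \<open>\<Theta> \<mapsto> von_mises \<Theta> \<kappa>\<close> a Markov kernel, so that the mixture over the phase can be evaluated.\<close>

lemma borel_measurable_emeasure_von_mises:
  assumes [measurable]: "A \<in> sets borel"
  shows "(\<lambda>\<Theta>. emeasure (von_mises \<Theta> \<kappa>) A) \<in> borel_measurable borel"
proof -
  have "(\<lambda>\<Theta>. emeasure (von_mises \<Theta> \<kappa>) A) =
    (\<lambda>\<Theta>. \<integral>\<^sup>+x. ennreal (exp (\<kappa> * cos (x - \<Theta>)) / bessel_I0 \<kappa>) * indicator A x \<partial>uniform_angle)"
    using nn_integral_von_mises[of "indicator A" _ \<kappa>] by simp
  also have "\<dots> \<in> borel_measurable borel"
    by measurable
  finally show ?thesis .
qed

text \<open>Expand \<open>cos (x - \<theta>)\<close> around \<open>\<Theta>\<close>; the sine part is odd and integrates to zero.\<close>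

lemma von_mises_mean_cos:
  "(\<integral>x. cos (x - \<theta>) \<partial>von_mises \<Theta> \<kappa>) = bessel_ratio \<kappa> * cos (\<Theta> - \<theta>)"
proof -
  have "(\<integral>x. cos (x - \<theta>) \<partial>von_mises \<Theta> \<kappa>) =
      (\<integral>x. exp (\<kappa> * cos (x - \<Theta>)) / bessel_I0 \<kappa> * cos ((x - \<Theta>) + (\<Theta> - \<theta>)) \<partial>uniform_angle)"
    unfolding von_mises_eq_density using bessel_I0_pos[of \<kappa>]
    by (subst integral_density) (auto intro!: AE_I2)
  also have "\<dots> = (\<integral>x. exp (\<kappa> * cos x) / bessel_I0 \<kappa> * cos (x + (\<Theta> - \<theta>)) \<partial>uniform_angle)"
    by (rule integral_uniform_angle_shift)
      (use bessel_I0_pos[of \<kappa>] in \<open>auto intro!: continuous_intros simp: cos_add sin_add\<close>)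
  also have "\<dots> = (\<integral>x. cos (\<Theta> - \<theta>) / bessel_I0 \<kappa> * (cos x * exp (\<kappa> * cos x))
      - sin (\<Theta> - \<theta>) / bessel_I0 \<kappa> * (sin x * exp (\<kappa> * cos x)) \<partial>uniform_angle)"
    by (intro Bochner_Integration.integral_cong refl, subst cos_add) (simp add: diff_divide_distrib algebra_simps)
  also have "\<dots> = cos (\<Theta> - \<theta>) / bessel_I0 \<kappa> * bessel_I1 \<kappa>
      - sin (\<Theta> - \<theta>) / bessel_I0 \<kappa> * (\<integral>x. sin x * exp (\<kappa> * cos x) \<partial>uniform_angle)"
    unfolding bessel_I1_eq
    by (subst Bochner_Integration.integral_diff)
      (auto intro!: integrable_uniform_angle continuous_intros simp del: times_divide_eq_left)
  also have "(\<integral>x. sin x * exp (\<kappa> * cos x) \<partial>uniform_angle) = 0"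
  proof (cases "\<kappa> = 0")
    case True
    have "(\<integral>x. sin x \<partial>uniform_angle) = 0"
      by (rule integral_uniform_angle_deriv_eq_0[where F = "\<lambda>x. - cos x"])
        (auto intro!: derivative_eq_intros continuous_intros)
    with True show ?thesis by simp
  next
    case False
    then show ?thesis
      by (intro integral_uniform_angle_deriv_eq_0[where F = "\<lambda>x. - exp (\<kappa> * cos x) / \<kappa>"])
        (auto intro!: derivative_eq_intros continuous_intros)
  qed
  finally show ?thesis
    by (simp add: bessel_ratio_def)
qed

lemma exp_le_quadratic:
  fixes y :: real
  assumes "\<bar>y\<bar> \<le> 1"
  shows "exp y \<le> 1 + y + y\<^sup>2"
proof (cases "y \<ge> 0")
  case True
  then show ?thesis using assms by (intro exp_bound) auto
next
  case False
  define z where "z = - y"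
  have z: "0 \<le> z" "z \<le> 1" using False assms by (auto simp: z_def)
  have "1 \<le> (1 - z + z\<^sup>2) * (1 + z)"
    using z by (simp add: algebra_simps power2_eq_square)
  also have "\<dots> \<le> (1 - z + z\<^sup>2) * exp z"
    using z by (intro mult_left_mono exp_ge_add_one_self add_nonneg_nonneg) auto
  finally have "exp (- z) \<le> 1 - z + z\<^sup>2"
    by (simp add: exp_minus field_simps)
  then show ?thesis by (simp add: z_def)
qed

text \<open>A second order bound is enough for the detection probability: \<open>l\<close> will be proportional to the gap
  between the mean of the cosine and the threshold, and only the sign of the exponent matters.\<close>

lemma von_mises_mgf_le:
  assumes "0 \<le> l" "l \<le> 1"
  shows "(\<integral>\<^sup>+x. ennreal (exp (- l * cos (x - \<theta>))) \<partial>von_mises \<Theta> \<kappa>)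
    \<le> ennreal (exp (l\<^sup>2 - l * (bessel_ratio \<kappa> * cos (\<Theta> - \<theta>))))"
proof -
  have int: "integrable (von_mises \<Theta> \<kappa>) (\<lambda>x. cos (x - \<theta>))"
    by (rule von_mises.integrable_const_bound[where B = 1]) auto
  have "(\<integral>\<^sup>+x. ennreal (exp (- l * cos (x - \<theta>))) \<partial>von_mises \<Theta> \<kappa>)
      \<le> (\<integral>\<^sup>+x. ennreal (1 + l\<^sup>2 - l * cos (x - \<theta>)) \<partial>von_mises \<Theta> \<kappa>)"
  proof (intro nn_integral_mono ennreal_leI)
    fix x
    have c: "\<bar>cos (x - \<theta>)\<bar> \<le> 1" by simp
    then have "\<bar>- l * cos (x - \<theta>)\<bar> \<le> 1"
      using assms mult_mono[of "\<bar>l\<bar>" 1 "\<bar>cos (x - \<theta>)\<bar>" 1] by (simp add: abs_mult)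
    then have "exp (- l * cos (x - \<theta>)) \<le> 1 + (- l * cos (x - \<theta>)) + (- l * cos (x - \<theta>))\<^sup>2"
      by (rule exp_le_quadratic)
    also have "(- l * cos (x - \<theta>))\<^sup>2 \<le> l\<^sup>2"
      using mult_left_mono[of "(cos (x - \<theta>))\<^sup>2" 1 "l\<^sup>2"] c
      by (simp add: power_mult_distrib abs_square_le_1)
    finally show "exp (- l * cos (x - \<theta>)) \<le> 1 + l\<^sup>2 - l * cos (x - \<theta>)"
      by simp
  qed
  also have "\<dots> = ennreal (\<integral>x. 1 + l\<^sup>2 - l * cos (x - \<theta>) \<partial>von_mises \<Theta> \<kappa>)"
  proof (intro nn_integral_eq_integral)
    show "integrable (von_mises \<Theta> \<kappa>) (\<lambda>x. 1 + l\<^sup>2 - l * cos (x - \<theta>))"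
      using int by auto
    show "AE x in von_mises \<Theta> \<kappa>. 0 \<le> 1 + l\<^sup>2 - l * cos (x - \<theta>)"
    proof (rule AE_I2)
      fix x 
      have "l * cos (x - \<theta>) \<le> 1"
        using mult_left_mono[OF cos_le_one[of "x - \<theta>"] assms(1)] assms(2) by simp
      then show "0 \<le> 1 + l\<^sup>2 - l * cos (x - \<theta>)"
        using zero_le_power2[of l] by linarith
    qed
  qed
  also have "(\<integral>x. 1 + l\<^sup>2 - l * cos (x - \<theta>) \<partial>von_mises \<Theta> \<kappa>) =
      1 + (l\<^sup>2 - l * (bessel_ratio \<kappa> * cos (\<Theta> - \<theta>)))"
    using int von_mises.prob_space by (simp add: von_mises_mean_cos)
  also have "\<dots> \<le> exp (l\<^sup>2 - l * (bessel_ratio \<kappa> * cos (\<Theta> - \<theta>)))"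
    by (rule exp_ge_add_one_self)
  finally show ?thesis
    by (simp add: ennreal_leI)
qed

text \<open>The sharp bound for the uniform law: it governs the union over all communities.\<close>

lemma uniform_angle_mgf_le:
  assumes "l \<ge> 0"
  shows "(\<integral>\<^sup>+x. ennreal (exp (l * cos (x - \<theta>))) \<partial>uniform_angle) \<le> ennreal (exp (l\<^sup>2 / 4))"
proof -
  have "(\<integral>\<^sup>+x. ennreal (exp (l * cos (x - \<theta>))) \<partial>uniform_angle) =
      (\<integral>\<^sup>+x. ennreal (exp (l * cos x)) \<partial>uniform_angle)"
    by (rule nn_integral_uniform_angle_shift) auto
  also have "\<dots> = ennreal (bessel_I0 l)"
    unfolding bessel_I0_eq
    by (intro nn_integral_eq_integral integrable_uniform_angle continuous_intros) auto
  also have "\<dots> \<le> ennreal (exp (l\<^sup>2 / 4))"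
    by (intro ennreal_leI bessel_I0_le assms)
  finally show ?thesis .
qed

lemma uniform_angle_arc_le:
  assumes "0 \<le> \<beta>" "\<beta> \<le> pi"
  shows "emeasure uniform_angle {x. cos \<beta> \<le> cos (x - \<theta>)} \<le> ennreal (\<beta> / pi)"
proof -
  have "emeasure uniform_angle {x. cos \<beta> \<le> cos (x - \<theta>)} =
      (\<integral>\<^sup>+x. indicator {u. cos \<beta> \<le> cos u} (x - \<theta>) \<partial>uniform_angle)"
    by (simp add: indicator_def flip: nn_integral_indicator)
  also have "\<dots> = (\<integral>\<^sup>+x. indicator {u. cos \<beta> \<le> cos u} x \<partial>uniform_angle)"
    by (rule nn_integral_uniform_angle_shift) (auto simp: indicator_def)
  also have "\<dots> = (\<integral>\<^sup>+x. indicator {u. cos \<beta> \<le> cos u} x * indicator {0..<2 * pi} x \<partial>lborel) / ennreal (2 * pi)"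
    by (rule nn_integral_uniform_angle) auto
  also have "\<dots> \<le> (\<integral>\<^sup>+x. indicator ({0..\<beta>} \<union> {2 * pi - \<beta>..2 * pi}) x \<partial>lborel) / ennreal (2 * pi)"
  proof (intro divide_right_mono_ennreal nn_integral_mono)
    fix u :: real
    have "u \<le> \<beta> \<or> 2 * pi - \<beta> \<le> u" if "0 \<le> u" "u < 2 * pi" "cos \<beta> \<le> cos u"
    proof (cases "u \<le> pi")
      case True
      then show ?thesis using that assms cos_mono_le_eq[of \<beta> u] by auto
    next
      case False
      have "cos \<beta> \<le> cos (2 * pi - u)" using that by (simp add: cos_diff)
      then show ?thesis using that False assms cos_mono_le_eq[of \<beta> "2 * pi - u"] by auto
    qed
    then show "indicator {u. cos \<beta> \<le> cos u} u * indicator {0..<2 * pi} u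
        \<le> (indicator ({0..\<beta>} \<union> {2 * pi - \<beta>..2 * pi}) u :: ennreal)"
      by (auto split: split_indicator)
  qed
  also have "\<dots> = emeasure lborel ({0..\<beta>} \<union> {2 * pi - \<beta>..2 * pi}) / ennreal (2 * pi)"
    by simp
  also have "\<dots> \<le> (ennreal \<beta> + ennreal \<beta>) / ennreal (2 * pi)"
    using assms
    by (intro divide_right_mono_ennreal order_trans[OF emeasure_subadditive]) auto
  also have "\<dots> = ennreal (\<beta> / pi)"
    using assms by (simp add: ennreal_plus[symmetric] divide_ennreal del: ennreal_plus)
  finally show ?thesis .
qed

lemma nn_integral_exp_affine:
  fixes c a :: real
  assumes "c \<noteq> 0"
  shows "(\<integral>\<^sup>+u. ennreal (exp (- (c * (u - a)))) * indicator {u. c * (u - a) \<ge> 0} u \<partial>lborel) = ennreal (1 / \<bar>c\<bar>)"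
proof -
  have "(\<integral>\<^sup>+u. ennreal (exp (- (c * (u - a)))) * indicator {u. c * (u - a) \<ge> 0} u \<partial>lborel) =
      ennreal \<bar>1 / c\<bar> * (\<integral>\<^sup>+y. ennreal (exp (- y)) * indicator {0..} y \<partial>lborel)"
    using assms
    by (subst nn_integral_real_affine[where c = "1 / c" and t = a])
      (auto intro!: arg_cong2[of _ _ _ _ "(*)"] nn_integral_cong split: split_indicator)
  then show ?thesis
    using nn_intergal_power_times_exp_Ici[of 0] by simp
qed

text \<open>Only the window \<open>[0, 1 / \<surd>\<kappa>]\<close> around the mode is kept; there \<open>\<kappa> * cos u\<close> loses at most \<open>1/2\<close>.\<close>

lemma bessel_I0_ge_sqrt:
  assumes "\<kappa> \<ge> 1"
  shows "exp (\<kappa> - 1 / 2) / sqrt \<kappa> \<le> 2 * pi * bessel_I0 \<kappa>"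
proof -
  have s: "0 < 1 / sqrt \<kappa>" "1 / sqrt \<kappa> \<le> 2 * pi"
    using assms pi_gt3 order_trans[of "1 / sqrt \<kappa>" 1 "2 * pi"] by auto
  have cos_ge: "1 - u\<^sup>2 / 2 \<le> cos u" for u :: real
  proof -
    have "\<bar>sin (u / 2)\<bar>\<^sup>2 \<le> \<bar>u / 2\<bar>\<^sup>2"
      by (intro power_mono abs_sin_x_le_abs_x) auto
    then show ?thesis
      using cos_double_sin[of "u / 2"] by (simp add: power2_eq_square)
  qed
  have "exp (\<kappa> - 1 / 2) / sqrt \<kappa> = integral {0..1 / sqrt \<kappa>} (\<lambda>u. exp (\<kappa> - 1 / 2))"
    using s by simp
  also have "\<dots> \<le> integral {0..1 / sqrt \<kappa>} (\<lambda>u. exp (\<kappa> * cos u))"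
  proof (intro integral_le integrable_continuous_interval continuous_intros)
    fix u assume u: "u \<in> {0..1 / sqrt \<kappa>}"
    have "u\<^sup>2 \<le> (1 / sqrt \<kappa>)\<^sup>2" using u by (intro power_mono) auto
    then have "\<kappa> * u\<^sup>2 \<le> 1" using assms by (simp add: power_divide field_simps)
    moreover have "\<kappa> * (1 - u\<^sup>2 / 2) \<le> \<kappa> * cos u"
      using assms by (intro mult_left_mono cos_ge) auto
    ultimately show "exp (\<kappa> - 1 / 2) \<le> exp (\<kappa> * cos u)"
      by (simp add: algebra_simps)
  qed
  also have "\<dots> \<le> integral {0..2 * pi} (\<lambda>u. exp (\<kappa> * cos u))"
    using s by (intro integral_subset_le integrable_continuous_interval continuous_intros) auto
  also have "\<dots> = 2 * pi * bessel_I0 \<kappa>"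
    by (simp add: bessel_I0_def)
  finally show ?thesis .
qed

lemma sin_ge_linear:
  assumes "0 \<le> x" "x \<le> pi / 2"
  shows "2 * x / pi \<le> sin x"
proof -
  have "convex_on {0..pi/2} (\<lambda>x. - sin x)"
    by (rule f''_ge0_imp_convex[where f' = "\<lambda>x. - cos x" and f'' = sin])
      (auto intro!: derivative_eq_intros sin_ge_zero)
  from convex_onD_Icc'[OF this, of x] assms show ?thesis
    by simp
qed

text \<open>\<open>cos \<alpha> - cos u\<close> is twice the product of the sines of \<open>(u + \<alpha>) / 2\<close> and \<open>(u - \<alpha>) / 2\<close>. The second sine is
  at least linear in \<open>u - \<alpha>\<close>, the first is bounded below by \<open>sin \<alpha> / 2\<close> on the whole range.\<close>

lemma cos_le_cos_minus_linear:
  assumes "0 \<le> \<alpha>" "\<alpha> \<le> u" "u \<le> pi"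
  shows "cos u \<le> cos \<alpha> - sin \<alpha> / pi * (u - \<alpha>)"
proof -
  define x where "x = (u - \<alpha>) / 2"
  define y where "y = (u + \<alpha>) / 2"
  have x: "0 \<le> x" "x \<le> pi / 2" using assms by (auto simp: x_def)
  have *: "cos \<alpha> - cos u = 2 * sin y * sin x"
    using cos_diff_cos[of \<alpha> u] by (simp add: x_def y_def add.commute)
  have 1: "(u - \<alpha>) / pi \<le> sin x"
  proof -
    have "2 * x / pi = (u - \<alpha>) / pi" by (simp add: x_def field_simps)
    then show ?thesis using sin_ge_linear[OF x] by simp
  qed
  have s0: "0 \<le> sin \<alpha>" using assms by (intro sin_ge_zero) auto
  have 2: "sin \<alpha> / 2 \<le> sin y"
  proof (cases "y \<le> pi / 2")
    case True
    then have "sin \<alpha> \<le> sin y"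
      using assms by (intro sin_monotone_2pi_le) (auto simp: y_def)
    then show ?thesis using s0 by simp
  next
    case False
    have "sin \<alpha> / 2 = sin (\<alpha> / 2) * cos (\<alpha> / 2)"
      using sin_double[of "\<alpha> / 2"] by simp
    also have "\<dots> \<le> 1 * cos (\<alpha> / 2)"
      using assms by (intro mult_right_mono cos_ge_zero) auto
    also have "\<dots> = sin (pi / 2 - \<alpha> / 2)"
      by (simp add: sin_diff)
    also have "\<dots> \<le> sin (pi - y)"
      using assms False by (intro sin_monotone_2pi_le) (auto simp: y_def field_simps)
    finally show ?thesis by simp
  qed
  have "2 * (sin \<alpha> / 2) * ((u - \<alpha>) / pi) \<le> 2 * sin y * sin x"
    using 1 2 s0 assms by (intro mult_mono) auto
  then show ?thesis unfolding *[symmetric] by simp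
qed

text \<open>Beyond \<open>\<alpha>\<close> the density decays exponentially at rate of order \<open>\<kappa>\<close>, so the tail integral is of order
  \<open>exp (\<kappa> * cos \<alpha>) / \<kappa>\<close>, whereas the normalisation is of order \<open>exp \<kappa> / \<surd>\<kappa>\<close>. The factor \<open>1 / \<surd>\<kappa>\<close> that is left
  over is needed: with \<open>\<kappa> (1 - cos \<alpha>) = 2 log k\<close> exactly, it alone makes the sum of the tails over the
  \<open>k (k - 1) / 2\<close> edges of the community vanish.\<close>

lemma von_mises_tail_le:
  assumes \<alpha>: "0 < \<alpha>" "\<alpha> < pi" and \<kappa>: "\<kappa> \<ge> 1"
  shows "emeasure (von_mises \<Theta> \<kappa>) {x. cos (x - \<Theta>) < cos \<alpha>}
    \<le> ennreal (12 / (sqrt \<kappa> * sin \<alpha>) * exp (- (\<kappa> * (1 - cos \<alpha>))))"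
proof -
  define c where "c = \<kappa> * (sin \<alpha> / pi)"
  have sin: "sin \<alpha> > 0" using \<alpha> by (intro sin_gt_zero) auto
  then have c: "c > 0" using \<kappa> by (simp add: c_def)
  define S where "S = {u. cos u < cos \<alpha>}"
  have [measurable]: "S \<in> sets borel" by (simp add: S_def)
  define K where "K = exp (\<kappa> * cos \<alpha>) / bessel_I0 \<kappa>"
  have K: "K \<ge> 0" using bessel_I0_pos[of \<kappa>] by (simp add: K_def)
  define g1 where "g1 u = ennreal (exp (- (c * (u - \<alpha>)))) * indicator {u. c * (u - \<alpha>) \<ge> 0} u" for u
  define g2 where "g2 u = ennreal (exp (- ((- c) * (u - (2 * pi - \<alpha>))))) * indicator {u. (- c) * (u - (2 * pi - \<alpha>)) \<ge> 0} u" for u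
  have [measurable]: "g1 \<in> borel_measurable borel" "g2 \<in> borel_measurable borel"
    unfolding g1_def[abs_def] g2_def[abs_def] by measurable
  have "emeasure (von_mises \<Theta> \<kappa>) {x. cos (x - \<Theta>) < cos \<alpha>} =
      (\<integral>\<^sup>+x. indicator S (x - \<Theta>) \<partial>von_mises \<Theta> \<kappa>)"
    by (simp add: indicator_def S_def flip: nn_integral_indicator)
  also have "\<dots> = (\<integral>\<^sup>+x. ennreal (exp (\<kappa> * cos (x - \<Theta>)) / bessel_I0 \<kappa>) * indicator S (x - \<Theta>) \<partial>uniform_angle)"
    by (subst nn_integral_von_mises) auto
  also have "\<dots> = (\<integral>\<^sup>+x. ennreal (exp (\<kappa> * cos x) / bessel_I0 \<kappa>) * indicator S x \<partial>uniform_angle)"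
    by (rule nn_integral_uniform_angle_shift[where f = "\<lambda>x. ennreal (exp (\<kappa> * cos x) / bessel_I0 \<kappa>) * indicator S x"])
      (auto simp: S_def indicator_def)
  also have "\<dots> = (\<integral>\<^sup>+x. ennreal (exp (\<kappa> * cos x) / bessel_I0 \<kappa>) * indicator S x * indicator {0..<2 * pi} x \<partial>lborel) / ennreal (2 * pi)"
    by (rule nn_integral_uniform_angle) auto
  also have "\<dots> \<le> (\<integral>\<^sup>+u. ennreal K * (g1 u + g2 u) \<partial>lborel) / ennreal (2 * pi)"
  proof (intro divide_right_mono_ennreal nn_integral_mono)
    fix u :: real
    \<comment> \<open>The complement of the arc consists of two mirror images, on each of which the density decays
      at least exponentially away from the end of the arc.\<close>
    have key: "ennreal (exp (\<kappa> * cos u) / bessel_I0 \<kappa>) \<le> ennreal K * ennreal (exp (- (c * (v - \<alpha>))))"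
      if "\<alpha> \<le> v" "v \<le> pi" "cos v = cos u" for v
    proof -
      have "\<kappa> * cos u \<le> \<kappa> * (cos \<alpha> - sin \<alpha> / pi * (v - \<alpha>))"
        using cos_le_cos_minus_linear[of \<alpha> v] that \<alpha> \<kappa> by (intro mult_left_mono) auto
      also have "\<dots> = \<kappa> * cos \<alpha> + - (c * (v - \<alpha>))"
        by (simp add: c_def right_diff_distrib)
      finally have "exp (\<kappa> * cos u) \<le> exp (\<kappa> * cos \<alpha>) * exp (- (c * (v - \<alpha>)))"
        by (simp flip: exp_add)
      then have "exp (\<kappa> * cos u) / bessel_I0 \<kappa> \<le> K * exp (- (c * (v - \<alpha>)))"
        using bessel_I0_pos[of \<kappa>] by (simp add: K_def divide_right_mono)
      then show ?thesis
        using K by (simp add: ennreal_leI flip: ennreal_mult)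
    qed
    show "ennreal (exp (\<kappa> * cos u) / bessel_I0 \<kappa>) * indicator S u * indicator {0..<2 * pi} u
        \<le> ennreal K * (g1 u + g2 u)"
    proof (cases "u \<in> S \<and> u \<in> {0..<2 * pi}")
      case True
      then have u: "cos u < cos \<alpha>" "0 \<le> u" "u < 2 * pi" by (auto simp: S_def)
      show ?thesis
      proof (cases "u \<le> pi")
        case True
        have "\<alpha> < u" using u True \<alpha> cos_mono_less_eq[of u \<alpha>] by auto
        then have "ennreal (exp (\<kappa> * cos u) / bessel_I0 \<kappa>) \<le> ennreal K * g1 u"
          using key[of u] True c by (simp add: g1_def)
        also have "\<dots> \<le> ennreal K * (g1 u + g2 u)"
          by (intro mult_left_mono) auto
        finally show ?thesis using u by (simp add: S_def)
      next
        case False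
        have cu: "cos (2 * pi - u) = cos u" by (simp add: cos_diff)
        have "\<alpha> < 2 * pi - u" using u cu False \<alpha> cos_mono_less_eq[of "2 * pi - u" \<alpha>] by auto
        then have "ennreal (exp (\<kappa> * cos u) / bessel_I0 \<kappa>) \<le> ennreal K * g2 u"
        proof -
          have "- c * (u - (2 * pi - \<alpha>)) = c * (2 * pi - u - \<alpha>)"
            by (simp add: algebra_simps)
          moreover have "0 \<le> c * (2 * pi - u - \<alpha>)"
            using c \<open>\<alpha> < 2 * pi - u\<close> by (intro mult_nonneg_nonneg) auto
          ultimately have "g2 u = ennreal (exp (- (c * (2 * pi - u - \<alpha>))))"
            by (simp only: g2_def) simp
          then show ?thesis
            using key[of "2 * pi - u"] cu False \<open>\<alpha> < 2 * pi - u\<close> by simp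
        qed
        also have "\<dots> \<le> ennreal K * (g1 u + g2 u)"
          by (intro mult_left_mono) auto
        finally show ?thesis using u by (simp add: S_def)
      qed
    qed (auto simp: indicator_def)
  qed
  also have "(\<integral>\<^sup>+u. ennreal K * (g1 u + g2 u) \<partial>lborel) = ennreal K * ((\<integral>\<^sup>+u. g1 u \<partial>lborel) + (\<integral>\<^sup>+u. g2 u \<partial>lborel))"
    by (simp add: nn_integral_cmult nn_integral_add)
  also have "\<dots> = ennreal K * (ennreal (1 / c) + ennreal (1 / c))"
    using c nn_integral_exp_affine[of c \<alpha>] nn_integral_exp_affine[of "- c" "2 * pi - \<alpha>"]
    unfolding g1_def g2_def by simp
  also have "\<dots> / ennreal (2 * pi) = ennreal (K * (2 / c) / (2 * pi))"
    using c K by (simp add: ennreal_plus[symmetric] ennreal_mult[symmetric] divide_ennreal del: ennreal_plus)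
  also have "\<dots> \<le> ennreal (12 / (sqrt \<kappa> * sin \<alpha>) * exp (- (\<kappa> * (1 - cos \<alpha>))))"
  proof (rule ennreal_leI)
    have e: "exp (1 / 2 :: real) \<le> 7 / 4"
      using exp_bound[of "1 / 2 :: real"] by (simp add: power2_eq_square)
    have "pi < 22 / 7" using pi_approx by simp
    then have pe: "pi * exp (1 / 2) \<le> 22 / 7 * (7 / 4)"
      using e by (intro mult_mono) auto
    have "K * (2 / c) / (2 * pi) = 2 / c * exp (\<kappa> * cos \<alpha>) / (2 * pi * bessel_I0 \<kappa>)"
      by (simp add: K_def)
    also have "\<dots> \<le> 2 / c * exp (\<kappa> * cos \<alpha>) / (exp (\<kappa> - 1 / 2) / sqrt \<kappa>)"
      using bessel_I0_ge_sqrt[OF \<kappa>] c \<kappa> by (intro divide_left_mono) (auto intro!: mult_pos_pos divide_pos_pos bessel_I0_pos)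
    also have "\<dots> = 2 * (pi * exp (1 / 2)) / (sqrt \<kappa> * sin \<alpha>) * exp (- (\<kappa> * (1 - cos \<alpha>)))"
    proof -
      have "exp (\<kappa> * cos \<alpha>) / exp (\<kappa> - 1 / 2) = exp (1 / 2) * exp (- (\<kappa> * (1 - cos \<alpha>)))"
        by (subst exp_diff[symmetric], subst exp_add[symmetric]) (simp add: algebra_simps)
      moreover have "sqrt \<kappa> / \<kappa> = 1 / sqrt \<kappa>"
        using \<kappa> by (simp add: real_div_sqrt field_simps)
      ultimately show ?thesis
        using \<kappa> sin by (simp add: c_def field_simps)
    qed
    also have "\<dots> \<le> 12 / (sqrt \<kappa> * sin \<alpha>) * exp (- (\<kappa> * (1 - cos \<alpha>)))"
      using pe \<kappa> sin by (intro mult_right_mono divide_right_mono) auto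
    finally show "K * (2 / c) / (2 * pi) \<le> 12 / (sqrt \<kappa> * sin \<alpha>) * exp (- (\<kappa> * (1 - cos \<alpha>)))" .
  qed
  finally show ?thesis .
qed

section \<open>Laws of the labels\<close>

lemma finite_edges [simp]: "finite C \<Longrightarrow> finite (edges C)"
  unfolding edges_def by (rule finite_subset[of _ "Pow C"]) auto

lemma edges_mono: "C \<subseteq> D \<Longrightarrow> edges C \<subseteq> edges D"
  by (auto simp: edges_def)

lemma card_edges: "finite C \<Longrightarrow> card (edges C) = card C choose 2"
  unfolding edges_def by (rule n_subsets)

definition label_law :: "real \<Rightarrow> nat set \<Rightarrow> real \<Rightarrow> nat set \<Rightarrow> real measure" where
  "label_law \<kappa> C \<Theta> e = (if e \<in> edges C then von_mises \<Theta> \<kappa> else uniform_angle)"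

lemma conditional_law_eq: "conditional_law n \<kappa> C \<Theta> = Pi\<^sub>M (edges {1..n}) (label_law \<kappa> C \<Theta>)"
  by (simp add: conditional_law_def label_law_def[abs_def])

lemma prob_space_label_law: "prob_space (label_law \<kappa> C \<Theta> e)"
  by (simp add: label_law_def prob_space_von_mises prob_space_uniform_angle)

lemma sets_label_law [measurable_cong, simp]: "sets (label_law \<kappa> C \<Theta> e) = sets borel"
  by (simp add: label_law_def)

lemma sets_conditional_law [measurable_cong, simp]:
  "sets (conditional_law n \<kappa> C \<Theta>) = sets (\<Pi>\<^sub>M e\<in>edges {1..n}. borel)"
  unfolding conditional_law_eq by (intro sets_PiM_cong) auto

lemma sets_null_law [measurable_cong, simp]:
  "sets (null_law n) = sets (\<Pi>\<^sub>M e\<in>edges {1..n}. borel)"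
  unfolding null_law_def by (intro sets_PiM_cong) auto

lemma measurable_label:
  assumes "sets M = sets (\<Pi>\<^sub>M e\<in>edges {1..n}. (borel :: real measure))" and "e \<in> edges {1..n}"
  shows "(\<lambda>X. X e) \<in> borel_measurable M"
  unfolding measurable_cong_sets[OF assms(1) refl] by (rule measurable_component_singleton) fact

lemma prob_space_conditional_law: "prob_space (conditional_law n \<kappa> C \<Theta>)"
  unfolding conditional_law_eq by (intro prob_space_PiM prob_space_label_law)

lemma prob_space_null_law: "prob_space (null_law n)"
  unfolding null_law_def by (intro prob_space_PiM prob_space_uniform_angle)

text \<open>On boxes the product measure is a finite product of one-edge probabilities, and boxes generate
  the product \<open>\<sigma>\<close>-algebra.\<close>

lemma measurable_conditional_law:
  "(\<lambda>\<Theta>. conditional_law n \<kappa> C \<Theta>) \<in> uniform_angle \<rightarrow>\<^sub>M subprob_algebra (\<Pi>\<^sub>M e\<in>edges {1..n}. borel)"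
proof -
  let ?I = "edges {1..n}"
  have "(\<lambda>\<Theta>. conditional_law n \<kappa> C \<Theta>) \<in> uniform_angle \<rightarrow>\<^sub>M prob_algebra (\<Pi>\<^sub>M e\<in>?I. borel)"
  proof (rule measurable_prob_algebra_generated[where \<Omega> = "\<Pi>\<^sub>E e\<in>?I. UNIV" and G = "prod_algebra ?I (\<lambda>e. borel)"])
    show "sets (\<Pi>\<^sub>M e\<in>?I. (borel :: real measure)) = sigma_sets (\<Pi>\<^sub>E e\<in>?I. UNIV) (prod_algebra ?I (\<lambda>e. borel))"
      by (simp add: sets_PiM)
    show "Int_stable (prod_algebra ?I (\<lambda>e. (borel :: real measure)))"
      by (rule Int_stable_prod_algebra)
    show "prod_algebra ?I (\<lambda>e. (borel :: real measure)) \<subseteq> Pow (\<Pi>\<^sub>E e\<in>?I. UNIV)"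
      using prod_algebra_sets_into_space[of ?I "\<lambda>e. borel :: real measure"] by simp
    fix S assume "S \<in> prod_algebra ?I (\<lambda>e. (borel :: real measure))"
    then obtain A where S: "S = Pi\<^sub>E ?I A" and A: "\<And>e. e \<in> ?I \<Longrightarrow> A e \<in> sets borel"
      by (auto simp: prod_algebra_eq_finite)
    have "emeasure (conditional_law n \<kappa> C \<Theta>) S = (\<Prod>e\<in>?I. emeasure (label_law \<kappa> C \<Theta> e) (A e))" for \<Theta>
    proof -
      interpret product_prob_space "label_law \<kappa> C \<Theta>" ?I
        by (intro product_prob_spaceI prob_space_label_law)
      show ?thesis
        unfolding S conditional_law_eq by (rule emeasure_PiM) (auto simp: A)
    qed
    moreover have "(\<lambda>\<Theta>. emeasure (label_law \<kappa> C \<Theta> e) (A e)) \<in> borel_measurable borel" if "e \<in> ?I" for e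
      using borel_measurable_emeasure_von_mises[OF A[OF that], of \<kappa>] by (cases "e \<in> edges C") (simp_all add: label_law_def)
    ultimately show "(\<lambda>\<Theta>. emeasure (conditional_law n \<kappa> C \<Theta>) S) \<in> borel_measurable uniform_angle"
      by (simp add: measurable_cong_sets[OF sets_uniform_angle refl] borel_measurable_prod_ennreal)
  qed (auto simp: prob_space_conditional_law)
  then show ?thesis
    by (rule measurable_prob_algebraD)
qed

text \<open>Independence: coordinates outside \<open>E\<close> contribute the total mass \<open>1\<close>.\<close>

lemma nn_integral_PiM_prod_subset:
  assumes M: "\<And>i. prob_space (M i)" and I: "finite I" "E \<subseteq> I"
    and g: "\<And>i. i \<in> E \<Longrightarrow> g i \<in> borel_measurable (M i)"
  shows "(\<integral>\<^sup>+X. (\<Prod>i\<in>E. g i (X i)) \<partial>Pi\<^sub>M I M) = (\<Prod>i\<in>E. \<integral>\<^sup>+x. g i x \<partial>M i)"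
proof -
  interpret product_prob_space M I
    by (intro product_prob_spaceI M)
  let ?g = "\<lambda>i. if i \<in> E then g i else (\<lambda>_. 1)"
  have "(\<integral>\<^sup>+X. (\<Prod>i\<in>E. g i (X i)) \<partial>Pi\<^sub>M I M) = (\<integral>\<^sup>+X. (\<Prod>i\<in>I. ?g i (X i)) \<partial>Pi\<^sub>M I M)"
    using I by (intro nn_integral_cong prod.mono_neutral_cong_left) auto
  also have "\<dots> = (\<Prod>i\<in>I. \<integral>\<^sup>+x. ?g i x \<partial>M i)"
    by (rule product_nn_integral_prod) (use I g in auto)
  also have "\<dots> = (\<Prod>i\<in>E. \<integral>\<^sup>+x. g i x \<partial>M i)"
    using I by (intro prod.mono_neutral_cong_right) (auto simp: prob_space.emeasure_space_1[OF M])
  finally show ?thesis .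
qed

lemma PiM_all_in_le:
  assumes M: "\<And>i. prob_space (M i)" and I: "finite I" "E \<subseteq> I"
    and A: "\<And>i. i \<in> E \<Longrightarrow> A i \<in> sets (M i)" and p: "p \<ge> 0" "\<And>i. i \<in> E \<Longrightarrow> emeasure (M i) (A i) \<le> ennreal p"
  shows "measure (Pi\<^sub>M I M) {X \<in> space (Pi\<^sub>M I M). \<forall>i\<in>E. X i \<in> A i} \<le> p ^ card E"
proof -
  have fE: "finite E" using I by (rule finite_subset[rotated])
  have [measurable]: "(\<lambda>X. X i) \<in> Pi\<^sub>M I M \<rightarrow>\<^sub>M M i" if "i \<in> E" for i
    using that I by (intro measurable_component_singleton) auto
  have ms: "{X \<in> space (Pi\<^sub>M I M). \<forall>i\<in>E. X i \<in> A i} \<in> sets (Pi\<^sub>M I M)"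
    using fE A by measurable
  have "emeasure (Pi\<^sub>M I M) {X \<in> space (Pi\<^sub>M I M). \<forall>i\<in>E. X i \<in> A i} =
      (\<integral>\<^sup>+X. indicator {X \<in> space (Pi\<^sub>M I M). \<forall>i\<in>E. X i \<in> A i} X \<partial>Pi\<^sub>M I M)"
    using ms by simp
  also have "\<dots> = (\<integral>\<^sup>+X. (\<Prod>i\<in>E. indicator (A i) (X i)) \<partial>Pi\<^sub>M I M)"
    using fE by (intro nn_integral_cong) (auto simp: indicator_def prod_zero_iff)
  also have "\<dots> = (\<Prod>i\<in>E. \<integral>\<^sup>+x. indicator (A i) x \<partial>M i)"
    by (rule nn_integral_PiM_prod_subset[OF M I]) (use A in auto)
  also have "\<dots> = (\<Prod>i\<in>E. emeasure (M i) (A i))"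
    using A by (intro prod.cong) auto
  also have "\<dots> \<le> (\<Prod>i\<in>E. ennreal p)"
    using p by (intro prod_mono_ennreal) auto
  also have "\<dots> = ennreal (p ^ card E)"
    using p by (simp add: ennreal_power)
  finally show ?thesis
    using p by (simp add: measure_def enn2real_leI)
qed

text \<open>Chernoff's bound for a sum over a subset of the coordinates.\<close>

lemma PiM_sum_ge_le:
  fixes h :: "'a \<Rightarrow> real" and b t :: real
  assumes M: "\<And>i. prob_space (M i)" and I: "finite I" "E \<subseteq> I"
    and h: "\<And>i. i \<in> E \<Longrightarrow> h \<in> borel_measurable (M i)"
    and mgf: "\<And>i. i \<in> E \<Longrightarrow> (\<integral>\<^sup>+x. ennreal (exp (h x)) \<partial>M i) \<le> ennreal (exp b)"
  shows "measure (Pi\<^sub>M I M) {X \<in> space (Pi\<^sub>M I M). t \<le> (\<Sum>i\<in>E. h (X i))} \<le> exp (card E * b - t)"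
proof -
  have fE: "finite E" using I by (rule finite_subset[rotated])
  have [measurable]: "(\<lambda>X. X i) \<in> Pi\<^sub>M I M \<rightarrow>\<^sub>M M i" if "i \<in> E" for i
    using that I by (intro measurable_component_singleton) auto
  have hm: "(\<lambda>X. h (X i)) \<in> borel_measurable (Pi\<^sub>M I M)" if "i \<in> E" for i
    using that by (intro measurable_compose[OF _ h]) auto
  have [measurable]: "(\<lambda>X. \<Sum>i\<in>E. h (X i)) \<in> borel_measurable (Pi\<^sub>M I M)"
    by (intro borel_measurable_sum hm)
  let ?S = "{X \<in> space (Pi\<^sub>M I M). t \<le> (\<Sum>i\<in>E. h (X i))}"
  have "emeasure (Pi\<^sub>M I M) ?S = (\<integral>\<^sup>+X. indicator ?S X \<partial>Pi\<^sub>M I M)"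
    by simp
  also have "\<dots> \<le> (\<integral>\<^sup>+X. ennreal (exp (- t)) * (\<Prod>i\<in>E. ennreal (exp (h (X i)))) \<partial>Pi\<^sub>M I M)"
  proof (intro nn_integral_mono)
    fix X
    have "(\<Prod>i\<in>E. ennreal (exp (h (X i)))) = ennreal (exp (\<Sum>i\<in>E. h (X i)))"
      by (simp add: prod_ennreal exp_sum fE)
    then have *: "ennreal (exp (- t)) * (\<Prod>i\<in>E. ennreal (exp (h (X i)))) = ennreal (exp ((\<Sum>i\<in>E. h (X i)) - t))"
      by (simp add: exp_diff exp_minus field_simps flip: ennreal_mult)
    show "indicator ?S X \<le> ennreal (exp (- t)) * (\<Prod>i\<in>E. ennreal (exp (h (X i))))"
      unfolding * by (auto simp: indicator_def)
  qed
  also have "\<dots> = ennreal (exp (- t)) * (\<integral>\<^sup>+X. (\<Prod>i\<in>E. ennreal (exp (h (X i)))) \<partial>Pi\<^sub>M I M)"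
    by (intro nn_integral_cmult borel_measurable_prod_ennreal measurable_compose[OF hm]) auto
  also have "(\<integral>\<^sup>+X. (\<Prod>i\<in>E. ennreal (exp (h (X i)))) \<partial>Pi\<^sub>M I M) = (\<Prod>i\<in>E. \<integral>\<^sup>+x. ennreal (exp (h x)) \<partial>M i)"
    by (rule nn_integral_PiM_prod_subset[OF M I]) (auto intro: measurable_compose[OF h])
  also have "ennreal (exp (- t)) * \<dots> \<le> ennreal (exp (- t)) * (\<Prod>i\<in>E. ennreal (exp b))"
    using mgf by (intro mult_left_mono prod_mono_ennreal) auto
  also have "\<dots> = ennreal (exp (card E * b - t))"
    by (simp add: ennreal_power exp_of_nat_mult[symmetric] exp_diff exp_minus field_simps flip: ennreal_mult)
  finally show ?thesis
    by (simp add: measure_def enn2real_leI)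
qed

text \<open>The exponent \<open>l\<^sup>2 / 4 - l * a\<close> per edge is minimal at \<open>l = 2 * a\<close>, with value \<open>- a\<^sup>2\<close>.\<close>

lemma null_law_sum_cos_ge_le:
  fixes a \<theta> :: real
  assumes "C \<subseteq> {1..n}" "a \<ge> 0"
  shows "measure (null_law n) {X \<in> space (null_law n). card (edges C) * a \<le> (\<Sum>e\<in>edges C. cos (X e - \<theta>))}
    \<le> exp (- (card (edges C) * a\<^sup>2))"
proof -
  let ?N = "real (card (edges C))"
  interpret prob_space "null_law n" by (rule prob_space_null_law)
  have [measurable]: "(\<lambda>X. X e) \<in> borel_measurable (null_law n)" if "e \<in> edges C" for e
    using that edges_mono[OF assms(1)] by (intro measurable_label) auto
  have sum [measurable]: "(\<lambda>X. \<Sum>e\<in>edges C. c * cos (X e - \<theta>)) \<in> borel_measurable (null_law n)" for c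
    by (intro borel_measurable_sum) simp
  have mono: "2 * a * (?N * a) \<le> (\<Sum>e\<in>edges C. 2 * a * cos (X e - \<theta>))"
    if "?N * a \<le> (\<Sum>e\<in>edges C. cos (X e - \<theta>))" for X :: "nat set \<Rightarrow> real"
    using mult_left_mono[OF that, of "2 * a"] assms(2) by (simp only: sum_distrib_left)
  have "measure (null_law n) {X \<in> space (null_law n). 2 * a * (?N * a) \<le> (\<Sum>e\<in>edges C. 2 * a * cos (X e - \<theta>))}
      \<le> exp (?N * ((2 * a)\<^sup>2 / 4) - 2 * a * (?N * a))"
    unfolding null_law_def using assms
    by (intro PiM_sum_ge_le prob_space_uniform_angle edges_mono uniform_angle_mgf_le finite_edges)
      (auto simp: measurable_cong_sets[OF sets_uniform_angle refl])
  also have "?N * ((2 * a)\<^sup>2 / 4) - 2 * a * (?N * a) = - (?N * a\<^sup>2)"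
    by (simp add: power2_eq_square)
  also have "measure (null_law n) {X \<in> space (null_law n). ?N * a \<le> (\<Sum>e\<in>edges C. cos (X e - \<theta>))} \<le>
    measure (null_law n) {X \<in> space (null_law n). 2 * a * (?N * a) \<le> (\<Sum>e\<in>edges C. 2 * a * cos (X e - \<theta>))}"
    by (rule finite_measure_mono) (auto intro: mono simp del: sets_null_law)
  finally show ?thesis .
qed

text \<open>Chernoff's bound with the minimiser \<open>l = (\<mu> - a) / 2\<close> of \<open>l\<^sup>2 - l * (\<mu> - a)\<close>.\<close>

lemma conditional_law_sum_cos_less_le:
  fixes a \<mu> \<theta> \<Theta> :: real
  assumes C: "C \<subseteq> {1..n}" and a: "0 \<le> a" "a \<le> \<mu>" "\<mu> \<le> 1" and \<mu>: "\<mu> \<le> bessel_ratio \<kappa> * cos (\<Theta> - \<theta>)"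
  shows "measure (conditional_law n \<kappa> C \<Theta>) {X \<in> space (conditional_law n \<kappa> C \<Theta>).
      \<not> card (edges C) * a \<le> (\<Sum>e\<in>edges C. cos (X e - \<theta>))} \<le> exp (- (card (edges C) * (\<mu> - a)\<^sup>2 / 4))"
proof -
  let ?N = "real (card (edges C))" and ?P = "conditional_law n \<kappa> C \<Theta>"
  define l where "l = (\<mu> - a) / 2"
  have l: "0 \<le> l" "l \<le> 1" using a by (auto simp: l_def)
  interpret prob_space ?P by (rule prob_space_conditional_law)
  have [measurable]: "(\<lambda>X. X e) \<in> borel_measurable ?P" if "e \<in> edges C" for e
    using that edges_mono[OF C] by (intro measurable_label) auto
  have [measurable]: "(\<lambda>X. \<Sum>e\<in>edges C. - l * cos (X e - \<theta>)) \<in> borel_measurable ?P"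
    by (intro borel_measurable_sum) simp
  have mono: "- (l * (?N * a)) \<le> (\<Sum>e\<in>edges C. - l * cos (X e - \<theta>))"
    if "\<not> ?N * a \<le> (\<Sum>e\<in>edges C. cos (X e - \<theta>))" for X :: "nat set \<Rightarrow> real"
    using mult_left_mono[of "\<Sum>e\<in>edges C. cos (X e - \<theta>)" "?N * a" l] that l(1)
    by (simp add: sum_distrib_left sum_negf)
  have *: "measure ?P {X \<in> space ?P. - (l * (?N * a)) \<le> (\<Sum>e\<in>edges C. - l * cos (X e - \<theta>))}
      \<le> exp (?N * (l\<^sup>2 - l * \<mu>) - - (l * (?N * a)))"
    unfolding conditional_law_eq
  proof (rule PiM_sum_ge_le)
    fix e assume e: "e \<in> edges C"
    have "(\<integral>\<^sup>+x. ennreal (exp (- l * cos (x - \<theta>))) \<partial>label_law \<kappa> C \<Theta> e)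
        \<le> ennreal (exp (l\<^sup>2 - l * (bessel_ratio \<kappa> * cos (\<Theta> - \<theta>))))"
      using von_mises_mgf_le[OF l] e by (simp add: label_law_def)
    also have "\<dots> \<le> ennreal (exp (l\<^sup>2 - l * \<mu>))"
      using \<mu> l by (auto intro!: ennreal_leI mult_left_mono)
    finally show "(\<integral>\<^sup>+x. ennreal (exp (- l * cos (x - \<theta>))) \<partial>label_law \<kappa> C \<Theta> e) \<le> ennreal (exp (l\<^sup>2 - l * \<mu>))" .
  qed (use C in \<open>auto intro!: prob_space_label_law edges_mono
      simp: measurable_cong_sets[OF sets_label_law refl]\<close>)
  have "measure ?P {X \<in> space ?P. \<not> ?N * a \<le> (\<Sum>e\<in>edges C. cos (X e - \<theta>))}
    \<le> measure ?P {X \<in> space ?P. - (l * (?N * a)) \<le> (\<Sum>e\<in>edges C. - l * cos (X e - \<theta>))}"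
    by (rule finite_measure_mono) (use mono in \<open>auto simp del: sets_conditional_law\<close>)
  also note *
  also have "?N * (l\<^sup>2 - l * \<mu>) - - (l * (?N * a)) = - (?N * (\<mu> - a)\<^sup>2 / 4)"
    by (simp add: l_def power2_eq_square field_simps)
  finally show ?thesis .
qed

text \<open>Under the null law each of the independent labels falls into an arc of half-width \<open>\<beta>\<close> with
  probability \<open>\<beta> / \<pi>\<close>.\<close>

lemma null_law_arc_le:
  assumes "C \<subseteq> {1..n}" "0 \<le> \<beta>" "\<beta> \<le> pi"
  shows "measure (null_law n) {X \<in> space (null_law n). \<forall>e\<in>edges C. cos \<beta> \<le> cos (X e - \<theta>)}
    \<le> (\<beta> / pi) ^ card (edges C)"
proof -
  have "measure (null_law n) {X \<in> space (null_law n). \<forall>e\<in>edges C. X e \<in> {x. cos \<beta> \<le> cos (x - \<theta>)}}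
    \<le> (\<beta> / pi) ^ card (edges C)"
    unfolding null_law_def using assms
    by (intro PiM_all_in_le prob_space_uniform_angle edges_mono finite_edges) (auto intro!: uniform_angle_arc_le)
  then show ?thesis by simp
qed

text \<open>Membership in an arc is expressed through the cosine, which spares reductions modulo \<open>2\<pi>\<close>. Enlarging
  the half-width from \<open>\<alpha>\<close> to \<open>\<beta>\<close> absorbs an error of up to \<open>\<beta> - \<alpha>\<close> in the centre.\<close>

lemma cos_ge_shift:
  assumes \<alpha>: "0 \<le> \<alpha>" and \<delta>: "\<bar>\<delta>\<bar> \<le> \<beta> - \<alpha>" and "\<beta> \<le> pi" and "cos \<alpha> \<le> cos u"
  shows "cos \<beta> \<le> cos (u + \<delta>)"
proof -
  define v where "v = arccos (cos u)"
  have v: "0 \<le> v" "v \<le> pi" "cos v = cos u" by (auto simp: v_def intro: arccos_lbound arccos_ubound)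
  then have "v \<le> \<alpha>" using assms cos_mono_le_eq[of \<alpha> v] by auto
  obtain x where "x \<in> \<int>" and x: "u = v + 2 * x * pi \<or> u = - v + 2 * x * pi"
    using v(3)[symmetric] unfolding cos_eq by auto
  then obtain k :: int where k: "x = of_int k" by (auto elim: Ints_cases)
  define w where "w = u - of_int k * (2 * pi)"
  have w: "w = v \<or> w = - v" using x by (auto simp: w_def k)
  have "cos (u + \<delta>) = cos \<bar>w + \<delta>\<bar>"
    using cos.minus_of_int[of "u + \<delta>" k] by (simp add: w_def algebra_simps)
  moreover have "\<bar>w + \<delta>\<bar> \<le> \<beta>"
    using w v \<delta> \<open>v \<le> \<alpha>\<close> by auto
  ultimately show ?thesis
    using assms cos_mono_le_eq[of \<beta> "\<bar>w + \<delta>\<bar>"] by auto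
qed

text \<open>Union bound over the edges of the community, each with the von Mises tail.\<close>

lemma conditional_law_arc_le:
  assumes C: "C \<subseteq> {1..n}" and \<alpha>: "0 < \<alpha>" "\<alpha> < pi" and \<kappa>: "\<kappa> \<ge> 1"
    and \<delta>: "\<bar>\<Theta> - \<theta>\<bar> \<le> \<beta> - \<alpha>" "\<beta> \<le> pi"
  shows "measure (conditional_law n \<kappa> C \<Theta>) {X \<in> space (conditional_law n \<kappa> C \<Theta>).
      \<not> (\<forall>e\<in>edges C. cos \<beta> \<le> cos (X e - \<theta>))}
    \<le> card (edges C) * (12 / (sqrt \<kappa> * sin \<alpha>) * exp (- (\<kappa> * (1 - cos \<alpha>))))"
proof -
  let ?P = "conditional_law n \<kappa> C \<Theta>"
  define q where "q = 12 / (sqrt \<kappa> * sin \<alpha>) * exp (- (\<kappa> * (1 - cos \<alpha>)))"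
  have q: "q \<ge> 0" using \<kappa> \<alpha> by (auto simp: q_def intro!: divide_nonneg_nonneg mult_nonneg_nonneg sin_ge_zero)
  interpret prob_space ?P by (rule prob_space_conditional_law)
  let ?B = "\<lambda>e. {X \<in> space ?P. \<forall>e'\<in>{e}. X e' \<in> {x. cos (x - \<Theta>) < cos \<alpha>}}"
  have fin: "finite (edges C)" using finite_subset[OF C] by simp
  have sub: "edges C \<subseteq> edges {1..n}" using C by (rule edges_mono)
  have meas: "?B e \<in> sets ?P" if "e \<in> edges C" for e
  proof -
    have [measurable]: "(\<lambda>X. X e) \<in> borel_measurable ?P"
      using that sub by (intro measurable_label) auto
    have "{X \<in> space ?P. cos (X e - \<Theta>) < cos \<alpha>} \<in> sets ?P"
      by measurable
    then show ?thesis by simp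
  qed
  have "measure ?P {X \<in> space ?P. \<not> (\<forall>e\<in>edges C. cos \<beta> \<le> cos (X e - \<theta>))} \<le> measure ?P (\<Union>e\<in>edges C. ?B e)"
  proof (rule finite_measure_mono)
    show "{X \<in> space ?P. \<not> (\<forall>e\<in>edges C. cos \<beta> \<le> cos (X e - \<theta>))} \<subseteq> (\<Union>e\<in>edges C. ?B e)"
    proof (rule subsetI)
      fix X assume "X \<in> {X \<in> space ?P. \<not> (\<forall>e\<in>edges C. cos \<beta> \<le> cos (X e - \<theta>))}"
      then obtain e where X: "X \<in> space ?P" "e \<in> edges C" "\<not> cos \<beta> \<le> cos (X e - \<theta>)"
        by auto
      have "cos (X e - \<Theta>) < cos \<alpha>"
        using cos_ge_shift[of \<alpha> "\<Theta> - \<theta>" \<beta> "X e - \<Theta>"] X \<alpha> \<delta> by force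
      then show "X \<in> (\<Union>e\<in>edges C. ?B e)" using X by auto
    qed
  qed (use fin meas in auto)
  also have "\<dots> \<le> (\<Sum>e\<in>edges C. measure ?P (?B e))"
    by (rule finite_measure_subadditive_finite) (use fin meas in auto)
  also have "\<dots> \<le> (\<Sum>e\<in>edges C. q ^ card {e})"
  proof (rule sum_mono)
    fix e assume e: "e \<in> edges C"
    show "measure ?P (?B e) \<le> q ^ card {e}"
      unfolding conditional_law_eq
    proof (rule PiM_all_in_le)
      show "emeasure (label_law \<kappa> C \<Theta> i) {x. cos (x - \<Theta>) < cos \<alpha>} \<le> ennreal q" if "i \<in> {e}" for i
        using von_mises_tail_le[OF \<alpha> \<kappa>] that e by (simp add: label_law_def q_def)
    qed (use e sub q in \<open>auto simp: prob_space_label_law\<close>)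
  qed
  finally show ?thesis by (simp add: q_def)
qed

text \<open>The planted law is a mixture over communities and phases, so a bound that is uniform in both carries over.\<close>

lemma p_miss_le:
  assumes k: "k \<le> n" and test: "is_test n \<phi>" and b: "b \<ge> 0"
    and le: "\<And>C \<Theta>. C \<subseteq> {1..n} \<Longrightarrow> card C = k \<Longrightarrow> 0 \<le> \<Theta> \<Longrightarrow> \<Theta> < 2 * pi \<Longrightarrow>
      measure (conditional_law n \<kappa> C \<Theta>) {X \<in> space (conditional_law n \<kappa> C \<Theta>). \<phi> X = 0} \<le> b"
  shows "p_miss n k \<kappa> \<phi> \<le> b"
proof -
  let ?N = "\<Pi>\<^sub>M e\<in>edges {1..n}. (borel :: real measure)"
  let ?F = "{C. C \<subseteq> {1..n} \<and> card C = k}"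
  let ?S = "{X \<in> space ?N. \<phi> X = 0}"
  let ?mix = "\<lambda>C. uniform_angle \<bind> (\<lambda>\<Theta>. conditional_law n \<kappa> C \<Theta>)"
  have F: "finite ?F" "?F \<noteq> {}"
    using k obtain_subset_with_card_n[of k "{1..n}"] by auto
  have S: "?S \<in> sets ?N"
    using measurable_sets[OF test[unfolded is_test_def], of "{0}"]
    by (simp add: vimage_def Int_def conj_commute)
  have mix: "?mix C \<in> space (subprob_algebra ?N)" for C
    by (rule uniform_angle.bind_in_space[OF measurable_conditional_law])
  then have mix': "?mix \<in> measure_pmf (pmf_of_set ?F) \<rightarrow>\<^sub>M subprob_algebra ?N"
    by simp
  have sets: "sets (planted_law n k \<kappa>) = sets ?N"
    unfolding planted_law_def using mix by (intro sets_bind) (simp_all add: space_subprob_algebra)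
  then have space: "space (planted_law n k \<kappa>) = space ?N"
    by (rule sets_eq_imp_space_eq)
  have "emeasure (planted_law n k \<kappa>) ?S = (\<integral>\<^sup>+C. emeasure (?mix C) ?S \<partial>measure_pmf (pmf_of_set ?F))"
    unfolding planted_law_def by (rule emeasure_bind[OF _ mix' S]) simp
  also have "\<dots> \<le> (\<integral>\<^sup>+C. ennreal b \<partial>measure_pmf (pmf_of_set ?F))"
  proof (rule nn_integral_mono_AE)
    show "AE C in measure_pmf (pmf_of_set ?F). emeasure (?mix C) ?S \<le> ennreal b"
    proof (rule AE_pmfI)
      fix C assume "C \<in> set_pmf (pmf_of_set ?F)"
      then have C: "C \<subseteq> {1..n}" "card C = k" using F by (auto simp: set_pmf_of_set)
      have "emeasure (?mix C) ?S = (\<integral>\<^sup>+\<Theta>. emeasure (conditional_law n \<kappa> C \<Theta>) ?S \<partial>uniform_angle)"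
        by (rule emeasure_bind[OF _ measurable_conditional_law S]) simp
      also have "\<dots> \<le> (\<integral>\<^sup>+\<Theta>. ennreal b \<partial>uniform_angle)"
      proof (rule nn_integral_mono_AE)
        have "AE \<Theta> in uniform_angle. \<Theta> \<in> {0..<2 * pi}"
          unfolding uniform_angle_def by (rule AE_uniform_measureI) auto
        then show "AE \<Theta> in uniform_angle. emeasure (conditional_law n \<kappa> C \<Theta>) ?S \<le> ennreal b"
        proof eventually_elim
          case (elim \<Theta>)
          interpret prob_space "conditional_law n \<kappa> C \<Theta>" by (rule prob_space_conditional_law)
          have "space (conditional_law n \<kappa> C \<Theta>) = space ?N"
            by (rule sets_eq_imp_space_eq) simp
          then show ?case
            using le[OF C, of \<Theta>] elim b by (simp add: emeasure_eq_measure ennreal_leI)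
        qed
      qed
      also have "\<dots> = ennreal b"
        using uniform_angle.emeasure_space_1 by simp
      finally show "emeasure (?mix C) ?S \<le> ennreal b" .
    qed
  qed
  also have "\<dots> = ennreal b" by simp
  finally have "emeasure (planted_law n k \<kappa>) ?S \<le> ennreal b" .
  then show ?thesis
    using b by (simp add: p_miss_def space measure_def enn2real_leI)
qed

section \<open>Union bounds over communities and phases\<close>

text \<open>The common form of all tests used here: reject when some community \<open>C\<close> and some phase number \<open>j\<close>
  from a finite grid show the pattern \<open>G\<close>. False alarms are controlled by the number of pairs
  \<open>(C, j)\<close>, misses by the true community and one grid phase near the true one. Since the grid is finite, no
  supremum over a continuum of phases has to be measurable.\<close>

lemma detection_by_union_bound:
  fixes k M :: "nat \<Rightarrow> nat" and \<kappa> p q :: "nat \<Rightarrow> real"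
    and G :: "nat \<Rightarrow> nat set \<Rightarrow> nat \<Rightarrow> (nat set \<Rightarrow> real) \<Rightarrow> bool"
  assumes k: "\<forall>\<^sub>F n in sequentially. 2 \<le> k n \<and> k n \<le> n"
    and meas: "\<And>n C j. C \<subseteq> {1..n} \<Longrightarrow>
      {X \<in> space (\<Pi>\<^sub>M e\<in>edges {1..n}. borel). G n C j X} \<in> sets (\<Pi>\<^sub>M e\<in>edges {1..n}. borel)"
    and fa: "\<forall>\<^sub>F n in sequentially. \<forall>C j. C \<subseteq> {1..n} \<longrightarrow> card C = k n \<longrightarrow> j < M n \<longrightarrow>
      measure (null_law n) {X \<in> space (null_law n). G n C j X} \<le> p n"
    and fa_lim: "(\<lambda>n. real (n choose k n) * real (M n) * p n) \<longlonglongrightarrow> 0"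
    and miss: "\<forall>\<^sub>F n in sequentially. \<forall>C \<Theta>. C \<subseteq> {1..n} \<longrightarrow> card C = k n \<longrightarrow> 0 \<le> \<Theta> \<longrightarrow> \<Theta> < 2 * pi \<longrightarrow>
      (\<exists>j<M n. measure (conditional_law n (\<kappa> n) C \<Theta>)
        {X \<in> space (conditional_law n (\<kappa> n) C \<Theta>). \<not> G n C j X} \<le> q n)"
    and miss_lim: "q \<longlonglongrightarrow> 0"
  shows "strong_detection_possible k \<kappa>"
proof -
  define F where "F n = {C. C \<subseteq> {1..n} \<and> card C = k n}" for n
  have F: "finite (F n)" "card (F n) = n choose k n" for n
    unfolding F_def by (simp_all add: n_subsets)
  define R where "R n X \<longleftrightarrow> (\<exists>C\<in>F n. \<exists>j<M n. G n C j X)" for n X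
  define \<phi> :: "nat \<Rightarrow> (nat set \<Rightarrow> real) \<Rightarrow> nat" where "\<phi> n X = (if R n X then 1 else 0)" for n X
  let ?P = "\<lambda>n. \<Pi>\<^sub>M e\<in>edges {1..n}. (borel :: real measure)"
  have UN: "{X \<in> space N. R n X} = (\<Union>C\<in>F n. \<Union>j<M n. {X \<in> space N. G n C j X})" for N n
    by (auto simp: R_def)
  have "{X \<in> space (?P n). R n X} \<in> sets (?P n)" for n
    unfolding UN using F(1) by (intro sets.finite_UN meas) (auto simp: F_def)
  then have test: "is_test n (\<phi> n)" for n
    unfolding is_test_def \<phi>_def[abs_def] by (intro measurable_If) auto
  have space_null: "space (null_law n) = space (?P n)" for n
    by (rule sets_eq_imp_space_eq) simp
  have "(\<lambda>n. p_fa n (\<phi> n)) \<longlonglongrightarrow> 0"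
  proof (rule tendsto_sandwich[OF _ _ tendsto_const fa_lim])
    show "\<forall>\<^sub>F n in sequentially. p_fa n (\<phi> n) \<le> real (n choose k n) * real (M n) * p n"
      using fa
    proof eventually_elim
      case (elim n)
      interpret prob_space "null_law n" by (rule prob_space_null_law)
      let ?B = "\<lambda>C j. {X \<in> space (null_law n). G n C j X}"
      have B: "?B C j \<in> sets (null_law n)" if "C \<in> F n" for C j
        using meas[of C n j] that by (simp add: F_def space_null)
      have "p_fa n (\<phi> n) = measure (null_law n) (\<Union>C\<in>F n. \<Union>j<M n. ?B C j)"
        unfolding UN[symmetric] p_fa_def \<phi>_def by (intro arg_cong[where f = "measure (null_law n)"]) auto
      also have "\<dots> \<le> (\<Sum>C\<in>F n. measure (null_law n) (\<Union>j<M n. ?B C j))"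
        using F(1) B by (intro finite_measure_subadditive_finite image_subsetI sets.finite_UN) auto
      also have "\<dots> \<le> (\<Sum>C\<in>F n. \<Sum>j<M n. measure (null_law n) (?B C j))"
        using B by (intro sum_mono finite_measure_subadditive_finite image_subsetI) auto
      also have "\<dots> \<le> (\<Sum>C\<in>F n. \<Sum>j<M n. p n)"
        using elim by (intro sum_mono) (auto simp: F_def)
      finally show ?case by (simp add: F(2) mult.assoc)
    qed
  qed (simp add: p_fa_def)
  moreover have "(\<lambda>n. p_miss n (k n) (\<kappa> n) (\<phi> n)) \<longlonglongrightarrow> 0"
  proof (rule tendsto_sandwich[OF _ _ tendsto_const miss_lim])
    show "\<forall>\<^sub>F n in sequentially. p_miss n (k n) (\<kappa> n) (\<phi> n) \<le> q n"
      using k miss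
    proof eventually_elim
      case (elim n)
      have le: "measure (conditional_law n (\<kappa> n) C \<Theta>)
          {X \<in> space (conditional_law n (\<kappa> n) C \<Theta>). \<phi> n X = 0} \<le> q n"
        if C: "C \<subseteq> {1..n}" "card C = k n" and \<Theta>: "0 \<le> \<Theta>" "\<Theta> < 2 * pi" for C \<Theta>
      proof -
        let ?L = "conditional_law n (\<kappa> n) C \<Theta>"
        interpret prob_space ?L by (rule prob_space_conditional_law)
        have space: "space ?L = space (?P n)" by (rule sets_eq_imp_space_eq) simp
        obtain j where j: "j < M n" and le: "measure ?L {X \<in> space ?L. \<not> G n C j X} \<le> q n"
          using elim(2) C \<Theta> by blast
        have "{X \<in> space ?L. \<not> G n C j X} = space ?L - {X \<in> space ?L. G n C j X}"
          by auto
        also have "\<dots> \<in> sets ?L"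
          using meas[OF C(1), of j] by (intro sets.compl_sets) (simp add: space)
        finally have "measure ?L {X \<in> space ?L. \<phi> n X = 0} \<le> measure ?L {X \<in> space ?L. \<not> G n C j X}"
          using j C by (intro finite_measure_mono) (auto simp: \<phi>_def R_def F_def split: if_splits)
        with le show ?thesis by simp
      qed
      obtain C where "C \<subseteq> {1..n}" "card C = k n"
        using elim(1) obtain_subset_with_card_n[of "k n" "{1..n}"] by auto
      \<comment> \<open>A bound on a probability is nonnegative; this needs an actual community.\<close>
      from le[OF this, of 0] have "q n \<ge> 0"
        using pi_gt_zero by (auto intro: order_trans[OF measure_nonneg])
      then show ?case
        using elim(1) test le by (intro p_miss_le) auto
    qed
  qed (simp add: p_miss_def)
  ultimately show ?thesis
    unfolding strong_detection_possible_def using test by blast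
qed

lemma phase_grid:
  assumes "0 \<le> \<Theta>" "\<Theta> < 2 * pi" "0 < M"
  obtains j where "j < M" "\<bar>\<Theta> - 2 * pi * real j / real M\<bar> \<le> 2 * pi / real M"
proof -
  define x where "x = \<Theta> * real M / (2 * pi)"
  define j where "j = nat \<lfloor>x\<rfloor>"
  have x: "0 \<le> x" "x < real M" using assms by (auto simp: x_def field_simps)
  then have j: "real j \<le> x" "x < real j + 1"
    by (auto simp: j_def)
  have "\<Theta> = 2 * pi / real M * x" using assms by (simp add: x_def)
  then have eq: "\<Theta> - 2 * pi * real j / real M = 2 * pi / real M * (x - real j)"
    by (simp add: right_diff_distrib)
  have "j < M" using x j by linarith
  moreover have "\<bar>\<Theta> - 2 * pi * real j / real M\<bar> \<le> 2 * pi / real M * 1"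
    unfolding eq abs_mult using j by (intro mult_mono) auto
  ultimately show ?thesis using that by simp
qed

lemma real_choose_2: "real (m choose 2) = real m * (real m - 1) / 2"
proof -
  have "even (m * (m - 1))" by (cases m) auto
  then show ?thesis
    by (cases m) (auto simp: choose_two real_of_nat_div algebra_simps)
qed

text \<open>Scan test: reject when the average of \<open>cos (X\<^sub>e - \<theta>)\<close> over \<open>edges C\<close> reaches a fixed fraction \<open>t\<close> of
  \<open>A(\<kappa>)\<close> for some \<open>C\<close> and some grid phase \<open>\<theta>\<close>. A false alarm for a given pair has probability at most
  \<open>exp (- t\<^sup>2 A\<^sup>2 k (k - 1) / 2)\<close>, and there are at most \<open>n\<^sup>k\<close> communities, so the test works as soon as
  \<open>A\<^sup>2 (k - 1) / 2\<close> exceeds \<open>log n\<close> by a constant factor.\<close>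

lemma scan_detection:
  assumes k: "\<forall>\<^sub>F n in sequentially. 2 \<le> k n \<and> k n \<le> n"
    and pos: "\<forall>\<^sub>F n in sequentially. 0 < bessel_ratio (\<kappa> n)"
    and \<eta>: "0 < \<eta>"
    and signal: "\<forall>\<^sub>F n in sequentially. (1 + \<eta>) * ln (real n) \<le> (real (k n) - 1) / 2 * (bessel_ratio (\<kappa> n))\<^sup>2"
  shows "strong_detection_possible k \<kappa>"
proof -
  \<comment> \<open>The margin \<open>\<eta>\<close> is split: the threshold \<open>t * A\<close> still beats the entropy with half of it, and the
    grid is so fine that a grid phase keeps a fraction \<open>s > t\<close> of the mean \<open>A\<close>.\<close>
  define t where "t = sqrt ((1 + \<eta> / 2) / (1 + \<eta>))"
  have "(1 + \<eta> / 2) / (1 + \<eta>) < 1" using \<eta> by simp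
  then have t: "0 < t" "t < 1" "t\<^sup>2 * (1 + \<eta>) = 1 + \<eta> / 2"
    using \<eta> by (auto simp: t_def)
  define s where "s = (1 + t) / 2"
  have s: "t < s" "s < 1" using t by (auto simp: s_def)
  have "(\<lambda>M. cos (2 * pi / real M)) \<longlonglongrightarrow> cos 0"
    by (intro tendsto_cos tendsto_divide_0[OF tendsto_const] filterlim_at_top_imp_at_infinity filterlim_real_sequentially)
  then have "\<forall>\<^sub>F M in sequentially. s < cos (2 * pi / real M)"
    using s by (intro order_tendstoD(1)[where y = "cos 0"]) auto
  then have "\<forall>\<^sub>F M in sequentially. s < cos (2 * pi / real M) \<and> 2 \<le> M"
    using eventually_ge_at_top[of 2] by (rule eventually_conj)
  then obtain M :: nat where M: "s < cos (2 * pi / real M)" "2 \<le> M"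
    by (auto simp: eventually_sequentially)
  define A where "A n = bessel_ratio (\<kappa> n)" for n
  define G where "G n C j X \<longleftrightarrow> real (card (edges C)) * (t * A n) \<le> (\<Sum>e\<in>edges C. cos (X e - 2 * pi * real j / real M))"
    for n C j and X :: "nat set \<Rightarrow> real"
  show ?thesis
  proof (rule detection_by_union_bound[where G = G and M = "\<lambda>_. M"
        and p = "\<lambda>n. exp (- (real (k n) * ((1 + \<eta> / 2) * ln (real n))))"
        and q = "\<lambda>n. exp (- ((s - t)\<^sup>2 / 4 * ln (real n)))"])
    show "\<forall>\<^sub>F n in sequentially. 2 \<le> k n \<and> k n \<le> n" by fact
  next
    fix n j :: nat and C assume C: "C \<subseteq> {1..n}"
    have [measurable]: "(\<lambda>X. \<Sum>e\<in>edges C. cos (X e - 2 * pi * real j / real M))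
        \<in> borel_measurable (\<Pi>\<^sub>M e\<in>edges {1..n}. (borel :: real measure))"
    proof (intro borel_measurable_sum)
      fix e assume "e \<in> edges C"
      then have [measurable]: "(\<lambda>X. X e) \<in> borel_measurable (\<Pi>\<^sub>M e\<in>edges {1..n}. (borel :: real measure))"
        using edges_mono[OF C] by (intro measurable_label) auto
      show "(\<lambda>X. cos (X e - 2 * pi * real j / real M)) \<in> borel_measurable (\<Pi>\<^sub>M e\<in>edges {1..n}. (borel :: real measure))"
        by measurable
    qed
    show "{X \<in> space (\<Pi>\<^sub>M e\<in>edges {1..n}. borel). G n C j X} \<in> sets (\<Pi>\<^sub>M e\<in>edges {1..n}. borel)"
      unfolding G_def by measurable
  next
    show "\<forall>\<^sub>F n in sequentially. \<forall>C j. C \<subseteq> {1..n} \<longrightarrow> card C = k n \<longrightarrow> j < M \<longrightarrow>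
      measure (null_law n) {X \<in> space (null_law n). G n C j X} \<le> exp (- (real (k n) * ((1 + \<eta> / 2) * ln (real n))))"
      using pos signal
    proof (eventually_elim, safe)
      fix n C j assume A: "0 < bessel_ratio (\<kappa> n)"
        and sig: "(1 + \<eta>) * ln (real n) \<le> (real (k n) - 1) / 2 * (bessel_ratio (\<kappa> n))\<^sup>2"
        and C: "C \<subseteq> {1..n}" "card C = k n"
      have N: "real (card (edges C)) = real (k n) * (real (k n) - 1) / 2"
        using C finite_subset[OF C(1)] by (simp add: card_edges real_choose_2)
      have "measure (null_law n) {X \<in> space (null_law n). G n C j X} \<le> exp (- (card (edges C) * (t * A n)\<^sup>2))"
        unfolding G_def using C t A by (intro null_law_sum_cos_ge_le) (auto simp: A_def)
      also have "real (card (edges C)) * (t * A n)\<^sup>2 = real (k n) * (t\<^sup>2 * ((real (k n) - 1) / 2 * (A n)\<^sup>2))"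
        unfolding N by (simp add: power_mult_distrib)
      also have "exp (- \<dots>) \<le> exp (- (real (k n) * (t\<^sup>2 * ((1 + \<eta>) * ln (real n)))))"
        using sig unfolding A_def
        by (simp only: exp_le_cancel_iff neg_le_iff_le) (intro mult_left_mono, auto)
      also have "t\<^sup>2 * ((1 + \<eta>) * ln (real n)) = (1 + \<eta> / 2) * ln (real n)"
        unfolding mult.assoc[symmetric] t ..
      finally show "measure (null_law n) {X \<in> space (null_law n). G n C j X}
          \<le> exp (- (real (k n) * ((1 + \<eta> / 2) * ln (real n))))" .
    qed
  next
    have lim: "(\<lambda>n. real M * exp (- (\<eta> / 2 * ln (real n)))) \<longlonglongrightarrow> 0"
      using \<eta> by real_asymp
    show "(\<lambda>n. real (n choose k n) * real M * exp (- (real (k n) * ((1 + \<eta> / 2) * ln (real n))))) \<longlonglongrightarrow> 0"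
    proof (rule tendsto_sandwich[OF _ _ tendsto_const lim])
      show "\<forall>\<^sub>F n in sequentially. real (n choose k n) * real M * exp (- (real (k n) * ((1 + \<eta> / 2) * ln (real n))))
          \<le> real M * exp (- (\<eta> / 2 * ln (real n)))"
        using k
      proof eventually_elim
        case (elim n)
        have ln: "ln (real n) \<ge> 0" using elim by simp
        have "n choose k n \<le> n ^ k n" using elim by (intro binomial_le_pow) simp
        then have "real (n choose k n) \<le> real n ^ k n"
          by (metis of_nat_le_iff of_nat_power)
        also have "\<dots> = exp (real (k n) * ln (real n))"
          using elim by (simp add: exp_of_nat_mult)
        finally have "real (n choose k n) * exp (- (real (k n) * ((1 + \<eta> / 2) * ln (real n))))
          \<le> exp (real (k n) * ln (real n)) * exp (- (real (k n) * ((1 + \<eta> / 2) * ln (real n))))"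
          by (rule mult_right_mono) simp
        also have "\<dots> = exp (- (real (k n) * (\<eta> / 2 * ln (real n))))"
          by (simp add: algebra_simps flip: exp_add)
        also have "\<dots> \<le> exp (- (1 * (\<eta> / 2 * ln (real n))))"
          using elim ln \<eta> by (simp only: exp_le_cancel_iff neg_le_iff_le) (intro mult_right_mono, auto)
        finally have "real (n choose k n) * exp (- (real (k n) * ((1 + \<eta> / 2) * ln (real n))))
           \<le> exp (- (\<eta> / 2 * ln (real n)))" by simp
        from mult_left_mono[OF this, of "real M"] show ?case by (simp add: mult_ac)
      qed
    qed simp
  next
    show "\<forall>\<^sub>F n in sequentially. \<forall>C \<Theta>. C \<subseteq> {1..n} \<longrightarrow> card C = k n \<longrightarrow> 0 \<le> \<Theta> \<longrightarrow> \<Theta> < 2 * pi \<longrightarrow>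
      (\<exists>j<M. measure (conditional_law n (\<kappa> n) C \<Theta>)
        {X \<in> space (conditional_law n (\<kappa> n) C \<Theta>). \<not> G n C j X} \<le> exp (- ((s - t)\<^sup>2 / 4 * ln (real n))))"
      using k pos signal
    proof (eventually_elim, safe)
      fix n C and \<Theta> :: real assume kn: "2 \<le> k n" "k n \<le> n" and A: "0 < bessel_ratio (\<kappa> n)"
        and sig: "(1 + \<eta>) * ln (real n) \<le> (real (k n) - 1) / 2 * (bessel_ratio (\<kappa> n))\<^sup>2"
        and C: "C \<subseteq> {1..n}" "card C = k n" and \<Theta>: "0 \<le> \<Theta>" "\<Theta> < 2 * pi"
      have N: "real (card (edges C)) = real (k n) * (real (k n) - 1) / 2"
        using C finite_subset[OF C(1)] by (simp add: card_edges real_choose_2)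
      obtain j where j: "j < M" "\<bar>\<Theta> - 2 * pi * real j / real M\<bar> \<le> 2 * pi / real M"
        using phase_grid[OF \<Theta>, of M] M by auto
      have "2 * pi / real M \<le> pi" using M by (simp add: field_simps)
      then have "cos (2 * pi / real M) \<le> cos \<bar>\<Theta> - 2 * pi * real j / real M\<bar>"
        using j by (intro cos_monotone_0_pi_le) auto
      then have c: "s \<le> cos (\<Theta> - 2 * pi * real j / real M)" using M by simp
      have "measure (conditional_law n (\<kappa> n) C \<Theta>) {X \<in> space (conditional_law n (\<kappa> n) C \<Theta>). \<not> G n C j X}
          \<le> exp (- (card (edges C) * (s * A n - t * A n)\<^sup>2 / 4))"
        unfolding G_def
      proof (rule conditional_law_sum_cos_less_le[OF C(1)])
        show "0 \<le> t * A n" "t * A n \<le> s * A n" "s * A n \<le> 1"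
          using t s A bessel_ratio_le_1[of "\<kappa> n"] mult_mono[of s 1 "A n" 1] by (auto simp: A_def)
        show "s * A n \<le> bessel_ratio (\<kappa> n) * cos (\<Theta> - 2 * pi * real j / real M)"
          using A c unfolding A_def by (simp add: mult.commute)
      qed
      also have "real (card (edges C)) * (s * A n - t * A n)\<^sup>2 / 4 =
          (s - t)\<^sup>2 / 4 * (real (k n) * ((real (k n) - 1) / 2 * (A n)\<^sup>2))"
        unfolding N by (simp add: power_mult_distrib flip: left_diff_distrib)
      also have "exp (- \<dots>) \<le> exp (- ((s - t)\<^sup>2 / 4 * (1 * (1 * ln (real n)))))"
      proof -
        have "1 * ln (real n) \<le> (1 + \<eta>) * ln (real n)"
          using \<eta> kn by (intro mult_right_mono) auto
        with sig have ln_le: "1 * ln (real n) \<le> (real (k n) - 1) / 2 * (A n)\<^sup>2" by (simp add: A_def)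
        have "1 * (1 * ln (real n)) \<le> real (k n) * ((real (k n) - 1) / 2 * (A n)\<^sup>2)"
          by (rule mult_mono[OF _ ln_le]) (use kn in auto)
        then show ?thesis
          by (simp only: exp_le_cancel_iff neg_le_iff_le) (intro mult_left_mono, auto)
      qed
      finally show "\<exists>j<M. measure (conditional_law n (\<kappa> n) C \<Theta>)
        {X \<in> space (conditional_law n (\<kappa> n) C \<Theta>). \<not> G n C j X} \<le> exp (- ((s - t)\<^sup>2 / 4 * ln (real n)))"
        using j by auto
    qed
  next
    have "0 < (s - t)\<^sup>2 / 4" using s by simp
    then show "(\<lambda>n. exp (- ((s - t)\<^sup>2 / 4 * ln (real n)))) \<longlonglongrightarrow> 0"
      by real_asymp
  qed
qed

text \<open>Arc test: reject when all labels on \<open>edges C\<close> lie in one arc of half-width \<open>\<beta>\<close> centred at a grid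
  phase. The labels of the true community lie within \<open>\<alpha>\<close> of the true phase with high probability; the grid spacing
  \<open>2\<pi> / M\<close> accounts for \<open>\<beta> - \<alpha>\<close>.\<close>

lemma arc_detection:
  fixes k M :: "nat \<Rightarrow> nat" and \<alpha> \<beta> \<kappa> :: "nat \<Rightarrow> real"
  assumes k: "\<forall>\<^sub>F n in sequentially. 2 \<le> k n \<and> k n \<le> n"
    and \<kappa>: "\<forall>\<^sub>F n in sequentially. 1 \<le> \<kappa> n"
    and arc: "\<forall>\<^sub>F n in sequentially. 0 < \<alpha> n \<and> 0 < M n \<and> \<alpha> n + 2 * pi / real (M n) \<le> \<beta> n \<and> \<beta> n \<le> pi"
    and fa: "(\<lambda>n. real (n choose k n) * real (M n) * (\<beta> n / pi) ^ (k n choose 2)) \<longlonglongrightarrow> 0"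
    and miss: "(\<lambda>n. real (k n choose 2) * (12 / (sqrt (\<kappa> n) * sin (\<alpha> n)) * exp (- (\<kappa> n * (1 - cos (\<alpha> n)))))) \<longlonglongrightarrow> 0"
  shows "strong_detection_possible k \<kappa>"
proof -
  define G where "G n C j X \<longleftrightarrow> (\<forall>e\<in>edges C. cos (\<beta> n) \<le> cos (X e - 2 * pi * real j / real (M n)))"
    for n C j and X :: "nat set \<Rightarrow> real"
  show ?thesis
  proof (rule detection_by_union_bound[where G = G, OF k _ _ fa _ miss])
    fix n j :: nat and C assume C: "C \<subseteq> {1..n}"
    have *: "{X \<in> space (\<Pi>\<^sub>M e\<in>edges {1..n}. (borel :: real measure)). cos (\<beta> n) \<le> cos (X e - 2 * pi * real j / real (M n))}
        \<in> sets (\<Pi>\<^sub>M e\<in>edges {1..n}. (borel :: real measure))" if "e \<in> edges C" for e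
    proof -
      have [measurable]: "(\<lambda>X. X e) \<in> borel_measurable (\<Pi>\<^sub>M e\<in>edges {1..n}. (borel :: real measure))"
        using edges_mono[OF C] that by (intro measurable_label) auto
      show ?thesis by measurable
    qed
    show "{X \<in> space (\<Pi>\<^sub>M e\<in>edges {1..n}. borel). G n C j X} \<in> sets (\<Pi>\<^sub>M e\<in>edges {1..n}. borel)"
      unfolding G_def using finite_subset[OF C] by (intro sets.sets_Collect_finite_All' sets.sets_Collect_finite_All *) auto
  next
    show "\<forall>\<^sub>F n in sequentially. \<forall>C j. C \<subseteq> {1..n} \<longrightarrow> card C = k n \<longrightarrow> j < M n \<longrightarrow>
      measure (null_law n) {X \<in> space (null_law n). G n C j X} \<le> (\<beta> n / pi) ^ (k n choose 2)"
      using arc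
    proof (eventually_elim, safe)
      fix n C j assume a: "0 < \<alpha> n" "0 < M n" "\<alpha> n + 2 * pi / real (M n) \<le> \<beta> n" "\<beta> n \<le> pi"
        and C: "C \<subseteq> {1..n}" "card C = k n"
      have "0 \<le> 2 * pi / real (M n)" by simp
      then have "0 \<le> \<beta> n" using a by linarith
      then show "measure (null_law n) {X \<in> space (null_law n). G n C j X} \<le> (\<beta> n / pi) ^ (k n choose 2)"
        using null_law_arc_le[OF C(1) _ a(4)] C finite_subset[OF C(1)] by (simp add: G_def card_edges)
    qed
  next
    show "\<forall>\<^sub>F n in sequentially. \<forall>C \<Theta>. C \<subseteq> {1..n} \<longrightarrow> card C = k n \<longrightarrow> 0 \<le> \<Theta> \<longrightarrow> \<Theta> < 2 * pi \<longrightarrow>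
      (\<exists>j<M n. measure (conditional_law n (\<kappa> n) C \<Theta>)
        {X \<in> space (conditional_law n (\<kappa> n) C \<Theta>). \<not> G n C j X}
        \<le> real (k n choose 2) * (12 / (sqrt (\<kappa> n) * sin (\<alpha> n)) * exp (- (\<kappa> n * (1 - cos (\<alpha> n))))))"
      using arc \<kappa>
    proof (eventually_elim, safe)
      fix n C and \<Theta> :: real assume a: "0 < \<alpha> n" "0 < M n" "\<alpha> n + 2 * pi / real (M n) \<le> \<beta> n" "\<beta> n \<le> pi"
        and \<kappa>n: "1 \<le> \<kappa> n" and C: "C \<subseteq> {1..n}" "card C = k n" and \<Theta>: "0 \<le> \<Theta>" "\<Theta> < 2 * pi"
      obtain j where j: "j < M n" "\<bar>\<Theta> - 2 * pi * real j / real (M n)\<bar> \<le> 2 * pi / real (M n)"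
        using phase_grid[OF \<Theta> a(2)] by auto
      have "0 < 2 * pi / real (M n)" using a by simp
      then have "\<alpha> n < pi" "\<bar>\<Theta> - 2 * pi * real j / real (M n)\<bar> \<le> \<beta> n - \<alpha> n" using a j by linarith+
      from conditional_law_arc_le[OF C(1) a(1) this(1) \<kappa>n this(2) a(4)]
      show "\<exists>j<M n. measure (conditional_law n (\<kappa> n) C \<Theta>)
        {X \<in> space (conditional_law n (\<kappa> n) C \<Theta>). \<not> G n C j X}
        \<le> real (k n choose 2) * (12 / (sqrt (\<kappa> n) * sin (\<alpha> n)) * exp (- (\<kappa> n * (1 - cos (\<alpha> n)))))"
        using j C finite_subset[OF C(1)] by (intro exI[of _ j]) (simp add: G_def card_edges)
    qed
  qed
qed

section \<open>The four regimes\<close>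

text \<open>The bound \<open>(e n / k)\<^sup>k\<close>, in exponential form. Its factor \<open>k\<^sup>-\<^sup>k\<close> is what the arc test needs for
  communities of logarithmic size.\<close>

lemma binomial_le_exp:
  assumes "1 \<le> k" "k \<le> n"
  shows "real (n choose k) \<le> exp (real k * (1 + ln (real n / real k)))"
proof -
  have "(\<Sum>i\<in>{k}. real k ^ i /\<^sub>R fact i) \<le> (\<Sum>i. real k ^ i /\<^sub>R fact i)"
    by (intro sum_le_suminf summable_exp_generic) auto
  then have "real k ^ k / fact k \<le> exp (real k)"
    by (simp add: exp_def field_simps)
  then have e: "real k ^ k * exp (- real k) \<le> fact k"
    by (simp add: exp_minus field_simps)
  have kp: "real k ^ k * exp (- real k) > 0" using assms by simp
  have "real (n choose k) * (real k ^ k * exp (- real k)) \<le> real (n choose k) * fact k"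
    by (intro mult_left_mono e) simp
  also have "\<dots> = real ((n choose k) * fact k)" by simp
  also have "\<dots> \<le> real (n ^ k)"
    using binomial_fact_pow[of n k] by (simp only: of_nat_le_iff)
  finally have "real (n choose k) \<le> real n ^ k / (real k ^ k * exp (- real k))"
    using kp by (simp add: pos_le_divide_eq)
  also have "\<dots> = (exp 1 * (real n / real k)) ^ k"
    by (simp add: power_mult_distrib power_divide exp_minus field_simps flip: exp_of_nat_mult)
  also have "exp 1 * (real n / real k) = exp (1 + ln (real n / real k))"
    using assms by (simp add: exp_add)
  finally show ?thesis
    by (simp add: exp_of_nat_mult)
qed

text \<open>With \<open>k\<close> about \<open>c log n\<close> the condition of the scan test reads \<open>A\<^sup>2 c > 2\<close>; rounding \<open>k\<close>
  changes only a bounded term.\<close>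

lemma detection_fixed_concentration:
  assumes k: "\<forall>\<^sub>F n in sequentially. 2 \<le> k n \<and> k n \<le> n"
    and size: "log_size c k" and \<kappa>: "\<forall>\<^sub>F n in sequentially. \<kappa> n = \<kappa>\<^sub>0" and pos: "\<kappa>\<^sub>0 > 0"
    and c: "(bessel_ratio \<kappa>\<^sub>0)\<^sup>2 * c > 2"
  shows "strong_detection_possible k \<kappa>"
proof -
  define A where "A = bessel_ratio \<kappa>\<^sub>0"
  \<comment> \<open>Half of the relative excess over the threshold; the other half absorbs the rounding of \<open>k\<close>.\<close>
  define \<eta> where "\<eta> = (A\<^sup>2 * c / 2 - 1) / 2"
  have \<eta>: "\<eta> > 0" using c by (simp add: \<eta>_def A_def)
  have "\<forall>\<^sub>F n in sequentially. A\<^sup>2 \<le> \<eta> * ln (real n)"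
    using \<eta> by real_asymp
  then have "\<forall>\<^sub>F n in sequentially. (1 + \<eta>) * ln (real n) \<le> (real (k n) - 1) / 2 * (bessel_ratio (\<kappa> n))\<^sup>2"
    using \<kappa> size[unfolded log_size_def]
  proof eventually_elim
    case (elim n)
    have "(1 + \<eta>) * ln (real n) = (1 + 2 * \<eta>) * ln (real n) - \<eta> * ln (real n)"
      by (simp add: algebra_simps)
    also have "\<dots> \<le> (1 + 2 * \<eta>) * ln (real n) - A\<^sup>2"
      using elim by simp
    also have "\<dots> = (c * ln (real n) - 2) / 2 * A\<^sup>2"
      by (simp add: \<eta>_def field_simps)
    also have "\<dots> \<le> (real (k n) - 1) / 2 * A\<^sup>2"
      using elim by (intro mult_right_mono) auto
    finally show ?case using elim by (simp add: A_def)
  qed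
  moreover have "\<forall>\<^sub>F n in sequentially. 0 < bessel_ratio (\<kappa> n)"
    using \<kappa> by eventually_elim (simp add: bessel_ratio_pos pos)
  ultimately show ?thesis
    using \<eta> k by (intro scan_detection)
qed

text \<open>The lower bound \<open>K\<close> on \<open>\<kappa>\<close> tends to \<open>0\<close>, where \<open>A(K)\<close> is about \<open>K / 2\<close>; then
  \<open>A\<^sup>2 (k - 1) / 2\<close> is about \<open>(1 + \<epsilon>)\<^sup>2 log n\<close>. Monotonicity of \<open>A\<close> covers larger \<open>\<kappa>\<close>.\<close>

lemma detection_large_community:
  assumes k: "\<forall>\<^sub>F n in sequentially. 2 \<le> k n \<and> k n \<le> n"
    and pos: "\<forall>\<^sub>F n in sequentially. \<kappa> n > 0" and \<epsilon>: "0 < \<epsilon>"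
    and size: "filterlim (\<lambda>n. real (k n) / ln (real n)) at_top sequentially"
    and \<kappa>: "\<forall>\<^sub>F n in sequentially. \<kappa> n \<ge> (1 + \<epsilon>) * sqrt (8 * ln (real n) / (real (k n) - 1))"
  shows "strong_detection_possible k \<kappa>"
proof -
  \<comment> \<open>The assumption bounds \<open>k\<close> below, but \<open>K\<close> involves \<open>k - 1\<close>: the quotients differ by \<open>1 / log n\<close>.\<close>
  define K where "K n = (1 + \<epsilon>) * sqrt (8 * ln (real n) / (real (k n) - 1))" for n
  have "filterlim (\<lambda>n. - (1 / ln (real n)) + real (k n) / ln (real n)) at_top sequentially"
  proof (rule filterlim_tendsto_add_at_top[OF _ size])
    show "(\<lambda>n. - (1 / ln (real n))) \<longlonglongrightarrow> 0" by real_asymp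
  qed
  then have "(\<lambda>n. inverse (- (1 / ln (real n)) + real (k n) / ln (real n))) \<longlonglongrightarrow> 0"
    by (rule tendsto_inverse_0_at_top)
  then have "(\<lambda>n. (1 + \<epsilon>) * sqrt (8 * inverse (- (1 / ln (real n)) + real (k n) / ln (real n)))) \<longlonglongrightarrow>
      (1 + \<epsilon>) * sqrt (8 * 0)"
    by (intro tendsto_intros)
  also have "(\<lambda>n. (1 + \<epsilon>) * sqrt (8 * inverse (- (1 / ln (real n)) + real (k n) / ln (real n)))) = K"
    by (simp add: K_def fun_eq_iff inverse_eq_divide flip: diff_divide_distrib)
  finally have K0: "K \<longlonglongrightarrow> 0" by simp
  have "(\<lambda>n. exp (- 4 * K n)) \<longlonglongrightarrow> exp (- 4 * 0)"
    by (intro tendsto_intros K0)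
  then have "\<forall>\<^sub>F n in sequentially. 1 / (1 + \<epsilon>) < exp (- 4 * K n)"
    using \<epsilon> by (intro order_tendstoD(1)) auto
  then have "\<forall>\<^sub>F n in sequentially. (1 + \<epsilon>) * ln (real n) \<le> (real (k n) - 1) / 2 * (bessel_ratio (\<kappa> n))\<^sup>2"
    using k \<kappa>
  proof eventually_elim
    case (elim n)
    have ln: "ln (real n) \<ge> 0" and k1: "real (k n) - 1 > 0" using elim by auto
    then have K: "K n \<ge> 0" using \<epsilon> by (simp add: K_def)
    have "(1 + \<epsilon>) * ln (real n) = (1 + \<epsilon>)\<^sup>2 * ln (real n) * (1 / (1 + \<epsilon>))"
      using \<epsilon> by (simp add: power2_eq_square)
    also have "\<dots> \<le> (1 + \<epsilon>)\<^sup>2 * ln (real n) * exp (- 4 * K n)"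
      using elim ln by (intro mult_left_mono) auto
    also have "(1 + \<epsilon>)\<^sup>2 * ln (real n) = (real (k n) - 1) / 2 * (K n / 2)\<^sup>2"
    proof -
      define y where "y = real (k n) - 1"
      show ?thesis
        using ln k1 unfolding K_def y_def[symmetric] by (simp add: power_mult_distrib power_divide)
    qed
    also have "\<dots> * exp (- 4 * K n) = (real (k n) - 1) / 2 * (K n / 2 * exp (- 2 * K n))\<^sup>2"
      using exp_double[of "- 2 * K n"] by (simp add: power_mult_distrib power_divide)
    also have "\<dots> \<le> (real (k n) - 1) / 2 * (bessel_ratio (\<kappa> n))\<^sup>2"
    proof (intro mult_left_mono power_mono)
      have "K n / 2 * exp (- 2 * K n) \<le> bessel_ratio (K n)"
        using K by (rule bessel_ratio_ge)
      also have "\<dots> \<le> bessel_ratio (\<kappa> n)"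
        using elim by (intro bessel_ratio_mono) (simp add: K_def)
      finally show "K n / 2 * exp (- 2 * K n) \<le> bessel_ratio (\<kappa> n)" .
    qed (use K k1 in auto)
    finally show ?case .
  qed
  moreover have "\<forall>\<^sub>F n in sequentially. 0 < bessel_ratio (\<kappa> n)"
    using pos by eventually_elim (rule bessel_ratio_pos)
  ultimately show ?thesis
    using \<epsilon> k by (intro scan_detection)
qed

text \<open>Arc test with the fixed half-width \<open>\<alpha> = \<pi> exp (- 2 / c)\<close>. Then \<open>(\<alpha> / \<pi>)\<close> to the power
  \<open>k (k - 1) / 2\<close> is \<open>n\<^sup>-\<^sup>k\<close> up to a factor \<open>exp (O(k))\<close>, and the factor \<open>k\<^sup>-\<^sup>k\<close> from the binomial coefficient
  still wins. This leaves room for enlarging the arc by \<open>1 / k\<close>, which costs another \<open>exp (O(k))\<close>, and so for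
  a grid of \<open>7 k\<close> phases.\<close>

lemma detection_log_community_large_concentration:
  assumes k: "\<forall>\<^sub>F n in sequentially. 2 \<le> k n \<and> k n \<le> n"
    and c: "c > 0" and size: "log_size c k"
    and \<kappa>: "\<forall>\<^sub>F n in sequentially. \<kappa> n \<ge> 2 * ln (real (k n)) / (1 - cos (pi * exp (- 2 / c)))"
  shows "strong_detection_possible k \<kappa>"
proof -
  define \<alpha> where "\<alpha> = pi * exp (- 2 / c)"
  have \<alpha>: "0 < \<alpha>" "\<alpha> < pi" using c by (auto simp: \<alpha>_def)
  then have sin: "sin \<alpha> > 0" by (rule sin_gt_zero)
  have cos: "cos \<alpha> < 1" using cos_monotone_0_pi[of 0 \<alpha>] \<alpha> by simp
  have k_lim: "filterlim (\<lambda>n. real (k n)) at_top sequentially"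
  proof (rule filterlim_at_top_mono)
    show "filterlim (\<lambda>n. c * ln (real n) - 1) at_top sequentially"
      using c by real_asymp
    show "\<forall>\<^sub>F n in sequentially. c * ln (real n) - 1 \<le> real (k n)"
      using size[unfolded log_size_def] by eventually_elim auto
  qed
  have "filterlim (\<lambda>x. 2 * ln x / (1 - cos \<alpha>)) at_top at_top"
    using cos by real_asymp
  from filterlim_compose[OF this k_lim]
  have \<kappa>_lim: "filterlim \<kappa> at_top sequentially"
    by (rule filterlim_at_top_mono) (use \<kappa> in \<open>simp add: \<alpha>_def\<close>)
  then have \<kappa>1: "\<forall>\<^sub>F n in sequentially. 1 \<le> \<kappa> n"
    by (simp add: filterlim_at_top)
  define D where "D = 1 + 2 / c + 1 / (2 * \<alpha>)"
  show ?thesis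
  proof (rule arc_detection[OF k \<kappa>1, where \<alpha> = "\<lambda>_. \<alpha>" and \<beta> = "\<lambda>n. \<alpha> + 1 / real (k n)" and M = "\<lambda>n. 7 * k n"])
    have "(\<lambda>n. 1 / real (k n)) \<longlonglongrightarrow> 0"
      using k_lim by (rule real_tendsto_divide_at_top[OF tendsto_const])
    then have "\<forall>\<^sub>F n in sequentially. 1 / real (k n) < pi - \<alpha>"
      using \<alpha> by (intro order_tendstoD(2)) auto
    then show "\<forall>\<^sub>F n in sequentially. 0 < \<alpha> \<and> 0 < 7 * k n \<and>
        \<alpha> + 2 * pi / real (7 * k n) \<le> \<alpha> + 1 / real (k n) \<and> \<alpha> + 1 / real (k n) \<le> pi"
      using k
    proof eventually_elim
      case (elim n)
      have "2 * pi \<le> 7" using pi_approx by simp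
      then have "2 * pi / real (7 * k n) \<le> 1 / real (k n)"
        using elim by (simp add: field_simps)
      then show ?case using elim \<alpha> by simp
    qed
  next
    have "((\<lambda>x. 7 * x * exp (D * x - x * ln x)) \<longlongrightarrow> 0) at_top"
      by real_asymp
    note lim = filterlim_compose[OF this k_lim]
    show "(\<lambda>n. real (n choose k n) * real (7 * k n) * ((\<alpha> + 1 / real (k n)) / pi) ^ (k n choose 2)) \<longlonglongrightarrow> 0"
    proof (rule tendsto_sandwich[OF _ _ tendsto_const lim])
      show "\<forall>\<^sub>F n in sequentially. real (n choose k n) * real (7 * k n) * ((\<alpha> + 1 / real (k n)) / pi) ^ (k n choose 2)
          \<le> 7 * real (k n) * exp (D * real (k n) - real (k n) * ln (real (k n)))"
        using k size[unfolded log_size_def]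
      proof eventually_elim
        case (elim n)
        define x where "x = real (k n)"
        have x: "x \<ge> 2" "x \<le> real n" using elim by (auto simp: x_def)
        have lx: "c * ln (real n) - 2 \<le> x - 1" using elim by (auto simp: x_def)
        have "(\<alpha> + 1 / x) / pi = exp (- 2 / c) * (1 + 1 / (x * \<alpha>))"
          using \<alpha> x by (simp add: \<alpha>_def field_simps)
        also have "\<dots> \<le> exp (- 2 / c) * exp (1 / (x * \<alpha>))"
          by (intro mult_left_mono exp_ge_add_one_self) auto
        finally have "(\<alpha> + 1 / x) / pi \<le> exp (- 2 / c + 1 / (x * \<alpha>))"
          by (simp only: exp_add)
        then have "((\<alpha> + 1 / x) / pi) ^ (k n choose 2) \<le> exp (- 2 / c + 1 / (x * \<alpha>)) ^ (k n choose 2)"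
          using \<alpha> x by (intro power_mono) auto
        also have "\<dots> = exp (x * (x - 1) / 2 * (- 2 / c + 1 / (x * \<alpha>)))"
          by (simp add: x_def real_choose_2 flip: exp_of_nat_mult)
        also have "x * (x - 1) / 2 * (- 2 / c + 1 / (x * \<alpha>)) = - (x * ((x - 1) / c)) + (x - 1) / (2 * \<alpha>)"
          using \<alpha> c x by (simp add: field_simps)
        finally have 1: "((\<alpha> + 1 / x) / pi) ^ (k n choose 2) \<le> exp (- (x * ((x - 1) / c)) + (x - 1) / (2 * \<alpha>))" .
        have 2: "real (n choose k n) \<le> exp (x * (1 + ln (real n / x)))"
          using elim unfolding x_def by (intro binomial_le_exp) auto
        have "real (n choose k n) * ((\<alpha> + 1 / x) / pi) ^ (k n choose 2)
          \<le> exp (x * (1 + ln (real n / x))) * exp (- (x * ((x - 1) / c)) + (x - 1) / (2 * \<alpha>))"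
          using 1 2 \<alpha> x by (intro mult_mono) auto
        also have "\<dots> = exp (x * (1 + ln (real n) - ln x) - x * ((x - 1) / c) + (x - 1) / (2 * \<alpha>))"
          using x by (simp add: ln_div flip: exp_add)
        also have "\<dots> \<le> exp (D * x - x * ln x)"
        proof -
          have "ln (real n) - 2 / c = (c * ln (real n) - 2) / c" using c by (simp add: field_simps)
          also have "\<dots> \<le> (x - 1) / c" using lx c by (intro divide_right_mono) auto
          finally have "x * (ln (real n) - 2 / c) \<le> x * ((x - 1) / c)" using x by (intro mult_left_mono) auto
          moreover have "(x - 1) / (2 * \<alpha>) \<le> x * (1 / (2 * \<alpha>))" using \<alpha> by (simp add: divide_right_mono)
          ultimately show ?thesis by (simp add: D_def algebra_simps)
        qed
        finally have "real (n choose k n) * ((\<alpha> + 1 / x) / pi) ^ (k n choose 2) \<le> exp (D * x - x * ln x)" .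
        from mult_left_mono[OF this, of "7 * x"] show ?case
          using x by (simp add: x_def mult_ac)
      qed
    qed (use \<alpha> in auto)
  next
    have lim: "(\<lambda>n. 6 / sin \<alpha> / sqrt (\<kappa> n)) \<longlonglongrightarrow> 0"
      by (intro real_tendsto_divide_at_top[OF tendsto_const] filterlim_compose[OF sqrt_at_top \<kappa>_lim])
    show "(\<lambda>n. real (k n choose 2) * (12 / (sqrt (\<kappa> n) * sin \<alpha>) * exp (- (\<kappa> n * (1 - cos \<alpha>))))) \<longlonglongrightarrow> 0"
    proof (rule tendsto_sandwich[OF _ _ tendsto_const lim])
      show "\<forall>\<^sub>F n in sequentially. real (k n choose 2) * (12 / (sqrt (\<kappa> n) * sin \<alpha>) * exp (- (\<kappa> n * (1 - cos \<alpha>))))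
        \<le> 6 / sin \<alpha> / sqrt (\<kappa> n)"
        using k \<kappa> \<kappa>1
      proof eventually_elim
        case (elim n)
        define x where "x = real (k n)"
        have x: "x \<ge> 2" using elim by (simp add: x_def)
        have "2 * ln x \<le> \<kappa> n * (1 - cos \<alpha>)"
          using elim cos by (simp add: x_def \<alpha>_def pos_divide_le_eq)
        then have "exp (- (\<kappa> n * (1 - cos \<alpha>))) \<le> exp (- (2 * ln x))" by simp
        also have "\<dots> = 1 / x\<^sup>2"
          using x by (simp add: exp_minus exp_double inverse_eq_divide)
        finally have e: "exp (- (\<kappa> n * (1 - cos \<alpha>))) \<le> 1 / x\<^sup>2" .
        have "real (k n choose 2) = x * (x - 1) / 2"
          by (simp add: real_choose_2 x_def)
        also have "\<dots> \<le> x\<^sup>2 / 2" using x by (simp add: power2_eq_square)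
        finally have "real (k n choose 2) * (12 / (sqrt (\<kappa> n) * sin \<alpha>) * exp (- (\<kappa> n * (1 - cos \<alpha>))))
            \<le> x\<^sup>2 / 2 * (12 / (sqrt (\<kappa> n) * sin \<alpha>) * (1 / x\<^sup>2))"
          using e sin elim by (intro mult_mono) auto
        also have "\<dots> = 6 / sin \<alpha> / sqrt (\<kappa> n)"
          using x by simp
        finally show ?case .
      qed
    qed (use sin \<kappa>1 in \<open>auto elim!: eventually_mono\<close>)
  qed
qed

text \<open>Arc test with a shrinking half-width \<open>\<beta> = \<pi> \<rho>\<close>. Put \<open>L = log (n / k)\<close> and \<open>Q = L / (k - 1)\<close>, both tending to
  infinity. A half-width \<open>\<pi> exp (- 2 Q)\<close> would balance the entropy \<open>k L\<close> of the communities; the assumed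
  strength of \<open>\<kappa>\<close> corresponds to \<open>exp (- 2 (1 + \<epsilon>) Q)\<close>, since the labels concentrate on the scale \<open>1 / \<surd>\<kappa>\<close>. The
  choice \<open>\<rho> = exp (- (2 + \<epsilon>) Q)\<close> is half way between and leaves an exponential margin on both sides: the entropy
  is beaten by \<open>\<epsilon> k L / 2\<close>, and \<open>\<kappa> \<rho>\<^sup>2\<close> still exceeds a multiple of \<open>log k\<close> by the factor \<open>R\<close>,
  which tends to infinity. The margin must also pay for the grid of about \<open>4 / \<rho>\<close> phases, that is for \<open>(2 + \<epsilon>) Q\<close>;
  this is where \<open>k > 3 / \<epsilon>\<close> enters.\<close>

lemma detection_small_community:
  assumes k: "\<forall>\<^sub>F n in sequentially. 2 \<le> k n \<and> k n \<le> n"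
    and \<epsilon>: "0 < \<epsilon>" "\<epsilon> < 1"
    and k\<epsilon>: "\<forall>\<^sub>F n in sequentially. 3 / \<epsilon> < real (k n)"
    and size: "(\<lambda>n. real (k n)) \<in> o(\<lambda>n. ln (real n))"
    and \<kappa>: "\<forall>\<^sub>F n in sequentially. \<kappa> n \<ge> (4 / pi\<^sup>2 + \<epsilon>) * ln (real (k n)) *
              (real n / real (k n)) powr (4 * (1 + \<epsilon>) / (real (k n) - 1))"
  shows "strong_detection_possible k \<kappa>"
proof -
  define L where "L n = ln (real n / real (k n))" for n
  have kL: "\<forall>\<^sub>F n in sequentially. Z * real (k n) \<le> L n" if "Z \<ge> 0" for Z
  proof -
    have "\<forall>\<^sub>F n in sequentially. norm (real (k n)) \<le> 1 / (Z + 1) * norm (ln (real n))"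
      using that by (intro landau_o.smallD[OF size]) auto
    then show ?thesis using k
    proof eventually_elim
      case (elim n)
      have "(Z + 1) * real (k n) \<le> ln (real n)"
        using elim that by (simp add: field_simps)
      moreover have "ln (real (k n)) \<le> real (k n)"
        using elim ln_le_minus_one[of "real (k n)"] by simp
      ultimately show ?case
        using elim by (simp add: L_def ln_div algebra_simps)
    qed
  qed
  define Q where "Q n = L n / (real (k n) - 1)" for n
  have k4: "\<forall>\<^sub>F n in sequentially. 4 \<le> real (k n) \<and> 3 < \<epsilon> * real (k n)"
    using k\<epsilon>
  proof eventually_elim
    case (elim n)
    have "3 < 3 / \<epsilon>" using \<epsilon> by (simp add: field_simps)
    then have "3 < k n" using elim by linarith
    then show ?case using elim \<epsilon> by (simp add: field_simps)
  qed
  have Q_lim: "filterlim Q at_top sequentially"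
    unfolding filterlim_at_top
  proof
    fix Z :: real
    show "\<forall>\<^sub>F n in sequentially. Z \<le> Q n"
      using kL[of "\<bar>Z\<bar>", OF abs_ge_zero] k4
    proof eventually_elim
      case (elim n)
      have "Z * (real (k n) - 1) \<le> \<bar>Z\<bar> * real (k n)"
        using elim by (intro mult_mono) auto
      then have "Z * (real (k n) - 1) \<le> L n" using elim by simp
      then show ?case using elim by (simp add: Q_def pos_le_divide_eq)
    qed
  qed
  have L_lim: "filterlim L at_top sequentially"
  proof (rule filterlim_at_top_mono[OF Q_lim])
    show "\<forall>\<^sub>F n in sequentially. Q n \<le> L n"
      using kL[OF order_refl] k4
    proof eventually_elim
      case (elim n)
      then have "L n * 1 \<le> L n * (real (k n) - 1)" by (intro mult_left_mono) auto
      then show ?case using elim by (simp add: Q_def pos_divide_le_eq)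
    qed
  qed
  define \<rho> where "\<rho> n = exp (- ((2 + \<epsilon>) * Q n))" for n
  define R where "R n = exp (2 * \<epsilon> * Q n)" for n
  have "filterlim (\<lambda>x. exp (2 * \<epsilon> * x)) at_top at_top" using \<epsilon> by real_asymp
  from filterlim_compose[OF this Q_lim] have R_lim: "filterlim R at_top sequentially"
    by (simp add: R_def[abs_def])
  have \<rho>: "0 < \<rho> n" for n by (simp add: \<rho>_def)
  have \<rho>1: "\<forall>\<^sub>F n in sequentially. \<rho> n \<le> 1"
    using filterlim_at_top[THEN iffD1, OF Q_lim, rule_format, of 0]
    by eventually_elim (use \<epsilon> in \<open>simp add: \<rho>_def\<close>)
  have \<kappa>\<rho>: "\<forall>\<^sub>F n in sequentially. 2 / 5 * ln (real (k n)) * R n \<le> \<kappa> n * (\<rho> n)\<^sup>2"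
    using k4 \<kappa> k
  proof eventually_elim
    case (elim n)
    have "pi\<^sup>2 \<le> (22 / 7)\<^sup>2" using pi_approx by (intro power_mono) auto
    also have "\<dots> \<le> 10" by (simp add: power2_eq_square)
    finally have "2 / 5 \<le> 4 / pi\<^sup>2" by (simp add: field_simps)
    then have "2 / 5 * ln (real (k n)) * exp (4 * (1 + \<epsilon>) * Q n)
        \<le> (4 / pi\<^sup>2 + \<epsilon>) * ln (real (k n)) * exp (4 * (1 + \<epsilon>) * Q n)"
      using \<epsilon> elim by (intro mult_right_mono) auto
    also have "\<dots> = (4 / pi\<^sup>2 + \<epsilon>) * ln (real (k n)) * (real n / real (k n)) powr (4 * (1 + \<epsilon>) / (real (k n) - 1))"
      using elim by (simp add: powr_def Q_def L_def)
    also have "\<dots> \<le> \<kappa> n"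
      by (rule elim)
    finally have "2 / 5 * ln (real (k n)) * exp (4 * (1 + \<epsilon>) * Q n) \<le> \<kappa> n" .
    then have "2 / 5 * ln (real (k n)) * exp (4 * (1 + \<epsilon>) * Q n) * (\<rho> n)\<^sup>2 \<le> \<kappa> n * (\<rho> n)\<^sup>2"
      by (rule mult_right_mono) simp
    also have "2 / 5 * ln (real (k n)) * exp (4 * (1 + \<epsilon>) * Q n) * (\<rho> n)\<^sup>2 = 2 / 5 * ln (real (k n)) * R n"
    proof -
      have "exp (4 * (1 + \<epsilon>) * Q n) * (\<rho> n)\<^sup>2 = R n"
        unfolding \<rho>_def R_def exp_double[symmetric] exp_add[symmetric] by (simp add: algebra_simps)
      then show ?thesis by (simp add: mult.assoc)
    qed
    finally show ?case .
  qed
  have ln1: "\<forall>\<^sub>F n in sequentially. 1 \<le> ln (real (k n))"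
    using k4
  proof eventually_elim
    case (elim n)
    have "exp 1 \<le> real (k n)" using elim exp_le by simp
    then show ?case using elim by (subst ln_ge_iff) auto
  qed
  have big: "\<forall>\<^sub>F n in sequentially. 1 \<le> ln (real (k n)) \<and> \<rho> n \<le> 1 \<and> 1 \<le> \<kappa> n * (\<rho> n)\<^sup>2 \<and> 1 \<le> \<kappa> n \<and>
      10 \<le> R n \<and> 2 / 5 * ln (real (k n)) * R n \<le> \<kappa> n * (\<rho> n)\<^sup>2"
    using \<kappa>\<rho> ln1 \<rho>1 filterlim_at_top[THEN iffD1, OF R_lim, rule_format, of 10]
  proof eventually_elim
    case (elim n)
    have "2 / 5 * 1 * 10 \<le> 2 / 5 * ln (real (k n)) * R n"
      using elim by (intro mult_mono) auto
    then have 1: "1 \<le> \<kappa> n * (\<rho> n)\<^sup>2" using elim by linarith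
    have "\<kappa> n \<ge> 0" using 1 \<rho>[of n] by (smt (verit) mult_nonpos_nonneg zero_le_power2)
    then have "\<kappa> n * (\<rho> n)\<^sup>2 \<le> \<kappa> n * 1"
      using elim \<rho>[of n] by (intro mult_left_mono power_le_one) auto
    then show ?case using 1 elim by simp
  qed
  define M where "M n = nat \<lceil>4 / \<rho> n\<rceil>" for n
  have M: "4 / \<rho> n \<le> real (M n)" "real (M n) \<le> 4 / \<rho> n + 1" "0 < M n" for n
  proof -
    have "0 < 4 / \<rho> n" using \<rho> by simp
    then show "4 / \<rho> n \<le> real (M n)" "real (M n) \<le> 4 / \<rho> n + 1" "0 < M n"
      unfolding M_def by linarith+
  qed
  show ?thesis
  proof (rule arc_detection[OF k, where \<alpha> = "\<lambda>n. pi * \<rho> n / 2" and \<beta> = "\<lambda>n. pi * \<rho> n" and M = M])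
    show "\<forall>\<^sub>F n in sequentially. 1 \<le> \<kappa> n"
      using big by eventually_elim simp
    show "\<forall>\<^sub>F n in sequentially. 0 < pi * \<rho> n / 2 \<and> 0 < M n \<and>
        pi * \<rho> n / 2 + 2 * pi / real (M n) \<le> pi * \<rho> n \<and> pi * \<rho> n \<le> pi"
      using \<rho>1
    proof eventually_elim
      case (elim n)
      have "2 * pi / real (M n) \<le> 2 * pi / (4 / \<rho> n)"
        using M[of n] \<rho>[of n] by (intro divide_left_mono) auto
      then show ?case using M[of n] \<rho>[of n] elim by simp
    qed
  next
    have "((\<lambda>x. 5 * exp (1 - \<epsilon> / 6 * x)) \<longlongrightarrow> 0) at_top" using \<epsilon> by real_asymp
    note lim = filterlim_compose[OF this L_lim]
    show "(\<lambda>n. real (n choose k n) * real (M n) * (pi * \<rho> n / pi) ^ (k n choose 2)) \<longlonglongrightarrow> 0"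
    proof (rule tendsto_sandwich[OF _ _ tendsto_const lim])
      show "\<forall>\<^sub>F n in sequentially. real (n choose k n) * real (M n) * (pi * \<rho> n / pi) ^ (k n choose 2)
          \<le> 5 * exp (1 - \<epsilon> / 6 * L n)"
        using k k4 \<rho>1 filterlim_at_top[THEN iffD1, OF L_lim, rule_format, of "6 / \<epsilon>"]
      proof eventually_elim
        case (elim n)
        define x where "x = real (k n)"
        have x: "4 \<le> x" "3 < \<epsilon> * x" using elim by (auto simp: x_def)
        have "0 < 6 / \<epsilon>" using \<epsilon> by simp
        then have "0 \<le> L n" using elim by linarith
        then have L: "6 \<le> \<epsilon> * L n" "0 \<le> L n" using elim \<epsilon> by (simp_all add: field_simps)
        have Q: "L n = (x - 1) * Q n" using x by (simp add: Q_def x_def)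
        have pw: "(pi * \<rho> n / pi) ^ (k n choose 2) = exp (- ((2 + \<epsilon>) * (x * L n / 2)))"
          unfolding \<rho>_def Q by (simp add: x_def real_choose_2 field_simps flip: exp_of_nat_mult)
        have "real (M n) \<le> 4 / \<rho> n + 1 / \<rho> n"
          using M(2)[of n] \<rho>[of n] elim by (auto simp: field_simps intro: order_trans)
        also have "\<dots> = 5 * exp ((2 + \<epsilon>) * Q n)"
          by (simp only: \<rho>_def exp_minus) (simp add: divide_inverse)
        finally have "real (n choose k n) * real (M n) * (pi * \<rho> n / pi) ^ (k n choose 2)
          \<le> exp (x * (1 + L n)) * (5 * exp ((2 + \<epsilon>) * Q n)) * exp (- ((2 + \<epsilon>) * (x * L n / 2)))"
          unfolding pw using binomial_le_exp[of "k n" n] elim unfolding x_def L_def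
          by (intro mult_mono) auto
        also have "\<dots> = 5 * exp (x + (2 + \<epsilon>) * Q n - \<epsilon> * x * L n / 2)"
          by (simp add: field_simps flip: exp_add)
        also have "\<dots> \<le> 5 * exp (x * (1 - \<epsilon> / 6 * L n))"
        proof -
          have "(2 + \<epsilon>) * Q n = (2 + \<epsilon>) / (x - 1) * L n" using x by (simp add: Q)
          also have "\<dots> \<le> (\<epsilon> * x / 3) * L n"
          proof (intro mult_right_mono)
            have "(2 + \<epsilon>) / (x - 1) \<le> 1" using x \<epsilon> by simp
            then show "(2 + \<epsilon>) / (x - 1) \<le> \<epsilon> * x / 3" using x by linarith
          qed (use L in auto)
          finally show ?thesis by (simp add: algebra_simps)
        qed
        also have "\<dots> \<le> 5 * exp (1 * (1 - \<epsilon> / 6 * L n))"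
          by (intro mult_left_mono exp_le_cancel_iff[THEN iffD2] mult_right_mono_neg) (use x L in auto)
        finally show ?case by simp
      qed
    qed (use \<rho> in \<open>auto simp: less_imp_le\<close>)
  next
    have "((\<lambda>x::real. 6 * exp (2 - x / 5)) \<longlongrightarrow> 0) at_top" by real_asymp
    note lim = filterlim_compose[OF this R_lim]
    show "(\<lambda>n. real (k n choose 2) * (12 / (sqrt (\<kappa> n) * sin (pi * \<rho> n / 2)) *
        exp (- (\<kappa> n * (1 - cos (pi * \<rho> n / 2)))))) \<longlonglongrightarrow> 0"
    proof (rule tendsto_sandwich[OF _ _ tendsto_const lim])
      show "\<forall>\<^sub>F n in sequentially. real (k n choose 2) * (12 / (sqrt (\<kappa> n) * sin (pi * \<rho> n / 2)) *
        exp (- (\<kappa> n * (1 - cos (pi * \<rho> n / 2))))) \<le> 6 * exp (2 - R n / 5)"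
        using big k4
      proof eventually_elim
        case (elim n)
        define x where "x = real (k n)"
        have x: "4 \<le> x" using elim by (simp add: x_def)
        have "\<rho> n \<le> sin (pi * \<rho> n / 2)"
          using sin_ge_linear[of "pi * \<rho> n / 2"] \<rho>[of n] elim by simp
        then have "sqrt (\<kappa> n) * \<rho> n \<le> sqrt (\<kappa> n) * sin (pi * \<rho> n / 2)"
          using elim by (intro mult_left_mono) auto
        moreover have "1 \<le> sqrt (\<kappa> n) * \<rho> n"
          using elim \<rho>[of n] real_sqrt_le_mono[of 1 "\<kappa> n * (\<rho> n)\<^sup>2"] by (simp add: real_sqrt_mult)
        ultimately have s: "1 \<le> sqrt (\<kappa> n) * sin (pi * \<rho> n / 2)" by linarith
        have "1 - cos (pi * \<rho> n / 2) = 2 * (sin (pi * \<rho> n / 4))\<^sup>2"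
          using cos_double_sin[of "pi * \<rho> n / 4"] by simp
        moreover have "\<rho> n / 2 \<le> sin (pi * \<rho> n / 4)"
          using sin_ge_linear[of "pi * \<rho> n / 4"] \<rho>[of n] elim by simp
        then have "(\<rho> n / 2)\<^sup>2 \<le> (sin (pi * \<rho> n / 4))\<^sup>2"
          using \<rho>[of n] by (intro power_mono) auto
        ultimately have "(\<rho> n)\<^sup>2 / 2 \<le> 1 - cos (pi * \<rho> n / 2)"
          by (simp add: power_divide)
        then have "\<kappa> n * ((\<rho> n)\<^sup>2 / 2) \<le> \<kappa> n * (1 - cos (pi * \<rho> n / 2))"
          using elim by (intro mult_left_mono) auto
        moreover have "ln x * (R n / 5) \<le> \<kappa> n * ((\<rho> n)\<^sup>2 / 2)"
          using elim by (simp add: x_def)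
        ultimately have "ln x * (R n / 5) \<le> \<kappa> n * (1 - cos (pi * \<rho> n / 2))"
          by (rule order_trans[rotated])
        then have e: "exp (- (\<kappa> n * (1 - cos (pi * \<rho> n / 2)))) \<le> exp (- (ln x * (R n / 5)))"
          by simp
        have x2: "x\<^sup>2 = exp (2 * ln x)" using x by (simp add: exp_double)
        have "real (k n choose 2) = x * (x - 1) / 2"
          by (simp add: real_choose_2 x_def)
        also have "\<dots> \<le> x\<^sup>2 / 2" using x by (simp add: power2_eq_square)
        finally have "real (k n choose 2) * (12 / (sqrt (\<kappa> n) * sin (pi * \<rho> n / 2)) *
            exp (- (\<kappa> n * (1 - cos (pi * \<rho> n / 2))))) \<le> x\<^sup>2 / 2 * (12 / 1 * exp (- (ln x * (R n / 5))))"
          using e s by (intro mult_mono divide_left_mono) auto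
        also have "\<dots> = 6 * exp (ln x * (2 - R n / 5))"
          unfolding x2 by (simp add: algebra_simps flip: exp_add)
        also have "\<dots> \<le> 6 * exp (1 * (2 - R n / 5))"
          by (intro mult_left_mono exp_le_cancel_iff[THEN iffD2] mult_right_mono_neg)
            (use elim in \<open>auto simp: x_def\<close>)
        finally show ?case by simp
      qed
      show "\<forall>\<^sub>F n in sequentially. 0 \<le> real (k n choose 2) * (12 / (sqrt (\<kappa> n) * sin (pi * \<rho> n / 2)) *
        exp (- (\<kappa> n * (1 - cos (pi * \<rho> n / 2)))))"
        using big
      proof eventually_elim
        case (elim n)
        then show ?case using \<rho>[of n]
          by (intro mult_nonneg_nonneg divide_nonneg_nonneg sin_ge_zero) auto
      qed
    qed
  qed
qed

theorem corollary7:
  fixes k :: "nat \<Rightarrow> nat" and \<kappa> :: "nat \<Rightarrow> real"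
  assumes "\<forall>\<^sub>F n in sequentially. 2 \<le> k n \<and> k n \<le> n"
    and "\<forall>\<^sub>F n in sequentially. \<kappa> n > 0"
  shows
    "((\<exists>\<epsilon>. 0 < \<epsilon> \<and> \<epsilon> < 1 \<and>
         (\<forall>\<^sub>F n in sequentially. 3 / \<epsilon> < real (k n)) \<and>
         (\<lambda>n. real (k n)) \<in> o(\<lambda>n. ln (real n)) \<and>
         (\<forall>\<^sub>F n in sequentially.
            \<kappa> n \<ge> (4 / pi\<^sup>2 + \<epsilon>) * ln (real (k n)) *
              (real n / real (k n)) powr (4 * (1 + \<epsilon>) / (real (k n) - 1))))
        \<longrightarrow> strong_detection_possible k \<kappa>) \<and>
     ((\<exists>c \<kappa>\<^sub>0. c > 2 \<and> log_size c k \<and>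
         (\<forall>\<^sub>F n in sequentially. \<kappa> n = \<kappa>\<^sub>0) \<and> (bessel_ratio \<kappa>\<^sub>0)\<^sup>2 * c > 2)
        \<longrightarrow> strong_detection_possible k \<kappa>) \<and>
     ((\<exists>c. c > 0 \<and> log_size c k \<and>
         (\<forall>\<^sub>F n in sequentially. \<kappa> n \<ge> 2 * ln (real (k n)) / (1 - cos (pi * exp (- 2 / c)))))
        \<longrightarrow> strong_detection_possible k \<kappa>) \<and>
     ((\<exists>\<epsilon>. 0 < \<epsilon> \<and> \<epsilon> < 1 \<and>
         filterlim (\<lambda>n. real (k n) / ln (real n)) at_top sequentially \<and>
         (\<forall>\<^sub>F n in sequentially. \<kappa> n \<ge> (1 + \<epsilon>) * sqrt (8 * ln (real n) / (real (k n) - 1))))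
        \<longrightarrow> strong_detection_possible k \<kappa>)"
proof (intro conjI impI; elim exE conjE)
  fix c \<kappa>\<^sub>0 assume c: "log_size c k" "\<forall>\<^sub>F n in sequentially. \<kappa> n = \<kappa>\<^sub>0" "(bessel_ratio \<kappa>\<^sub>0)\<^sup>2 * c > 2"
  have "\<forall>\<^sub>F n in sequentially. \<kappa>\<^sub>0 > 0"
    using c(2) assms(2) by eventually_elim simp
  then have "\<kappa>\<^sub>0 > 0" by simp
  then show "strong_detection_possible k \<kappa>"
    using detection_fixed_concentration[OF assms(1) c(1,2) _ c(3)] by simp
qed (rule detection_small_community[OF assms(1)] detection_log_community_large_concentration[OF assms(1)]
    detection_large_community[OF assms]; assumption)+

end
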